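(* A graph $G$ is a weakly threshold graph if and only if $G$ can be obtained by beginning with a graph isomorphic to $K_1$ or to $P_4$ and iteratively adding to the graph (zero or more times) either a dominating vertex, an isolated vertex, a weakly dominating vertex, a weakly isolated vertex, or a semi-joined $P_4$.
   Context: Graphs are finite and simple, with at least one vertex. $K_1$ is the one-vertex graph and $P_4$ is the path on four vertices. For a degree sequence $d=(d_1,\dots,d_n)$ (terms in nonincreasing order) put $m(d)=\max\{i : d_i\ge i-1\}$ and, for $1\le k\le m(d)$, $\Delta_k(d)=k(k-1)+\sum_{i>k}\min\{k,d_i\}-\sum_{i=1}^k d_i$. A degree sequence $d$ is a weakly threshold sequence if $\Delta_k(d)\le 1$ for all $k\in\{1,\dots,m(d)\}$, and a weakly threshold graph is a graph whose degree sequence is weakly threshold. Operations on a graph $G'$ (all of them add new vertices and do not change adjacencies among the existing vertices of $G'$): - adding a dominating vertex: add one new vertex adjacent to every vertex of $G'$; - adding an isolated vertex: add one new vertex adjacent to no vertex of $G'$; - adding a weakly dominating vertex: add one new vertex adjacent to every vertex of $G'$ except exactly one, this non-neighbor being a vertex of minimum degree in $G'$; - adding a weakly isolated vertex: add one new vertex adjacent to exactly one vertex of $G'$, this neighbor being a vertex of maximum degree in $G'$; - adding a semi-joined $P_4$: add four new vertices inducing a $P_4$, such that the two midpoints of the path are adjacent to every vertex of $G'$ and the two endpoints of the path are adjacent to no vertex of $G'$. *)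

theory Defs
  imports Complex_Main "HOL-Library.Multiset"
begin

definition simple_graph :: "'a set \<Rightarrow> 'a set set \<Rightarrow> bool" where
  "simple_graph V E \<longleftrightarrow>
     finite V \<and> V \<noteq> {} \<and> E \<subseteq> {{u, v} | u v. u \<in> V \<and> v \<in> V \<and> u \<noteq> v}"

definition graph_iso ::
    "'a set \<Rightarrow> 'a set set \<Rightarrow> 'b set \<Rightarrow> 'b set set \<Rightarrow> bool" where
  "graph_iso V E V' E' \<longleftrightarrow>
     (\<exists>f. bij_betw f V V' \<and>
          (\<forall>u\<in>V. \<forall>v\<in>V. {u, v} \<in> E \<longleftrightarrow> {f u, f v} \<in> E'))"

definition degree :: "'a set \<Rightarrow> 'a set set \<Rightarrow> 'a \<Rightarrow> nat" where
  "degree V E v = card {u \<in> V. {u, v} \<in> E}"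

definition min_degree_vertex :: "'a set \<Rightarrow> 'a set set \<Rightarrow> 'a \<Rightarrow> bool" where
  "min_degree_vertex V E w \<longleftrightarrow> w \<in> V \<and> (\<forall>u\<in>V. degree V E w \<le> degree V E u)"

definition max_degree_vertex :: "'a set \<Rightarrow> 'a set set \<Rightarrow> 'a \<Rightarrow> bool" where
  "max_degree_vertex V E w \<longleftrightarrow> w \<in> V \<and> (\<forall>u\<in>V. degree V E u \<le> degree V E w)"

definition degree_sequence :: "'a set \<Rightarrow> 'a set set \<Rightarrow> nat list" where
  "degree_sequence V E =
     rev (sorted_list_of_multiset (image_mset (degree V E) (mset_set V)))"

text \<open>
  Sequences are indexed from 1 in the mathematics and from 0 as lists, so that the
  term \<open>d\<^sub>i\<close> is \<open>d ! (i - 1)\<close>. The next three definitions are meant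
  for degree sequences of graphs; these are nonempty and nonincreasing.
  \<open>EG_diff d k\<close> is the slack in the \<open>k\<close>-th Erdos-Gallai inequality, usually
  written \<open>\<Delta>\<^sub>k(d)\<close>; it is integer-valued to avoid truncated subtraction.
\<close>

definition m_index :: "nat list \<Rightarrow> nat" where
  "m_index d = Max {i. 1 \<le> i \<and> i \<le> length d \<and> d ! (i - 1) \<ge> i - 1}"

definition EG_diff :: "nat list \<Rightarrow> nat \<Rightarrow> int" where
  "EG_diff d k =
     int k * (int k - 1)
     + (\<Sum>i = k + 1..length d. int (min k (d ! (i - 1))))
     - (\<Sum>i = 1..k. int (d ! (i - 1)))"

definition weakly_threshold_sequence :: "nat list \<Rightarrow> bool" where
  "weakly_threshold_sequence d \<longleftrightarrow> (\<forall>k\<in>{1..m_index d}. EG_diff d k \<le> 1)"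

definition weakly_threshold_graph :: "'a set \<Rightarrow> 'a set set \<Rightarrow> bool" where
  "weakly_threshold_graph V E \<longleftrightarrow>
     simple_graph V E \<and> weakly_threshold_sequence (degree_sequence V E)"

definition K1_verts :: "nat set" where "K1_verts = {0}"
definition K1_edges :: "nat set set" where "K1_edges = {}"

definition P4_verts :: "nat set" where "P4_verts = {0, 1, 2, 3}"
definition P4_edges :: "nat set set" where "P4_edges = {{0, 1}, {1, 2}, {2, 3}}"

text \<open>
  The new vertices may be arbitrary elements of the vertex type outside the current
  vertex set, so the predicate is closed under isomorphism within that type.
\<close>

inductive buildable :: "'a set \<Rightarrow> 'a set set \<Rightarrow> bool" where
  K1: "simple_graph V E \<Longrightarrow> graph_iso V E K1_verts K1_edges \<Longrightarrow> buildable V E"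
| P4: "simple_graph V E \<Longrightarrow> graph_iso V E P4_verts P4_edges \<Longrightarrow> buildable V E"
| dominating:
    "buildable V E \<Longrightarrow> x \<notin> V \<Longrightarrow>
     buildable (insert x V) (E \<union> {{x, u} | u. u \<in> V})"
| isolated:
    "buildable V E \<Longrightarrow> x \<notin> V \<Longrightarrow> buildable (insert x V) E"
| weakly_dominating:
    "buildable V E \<Longrightarrow> x \<notin> V \<Longrightarrow> min_degree_vertex V E w \<Longrightarrow>
     buildable (insert x V) (E \<union> {{x, u} | u. u \<in> V - {w}})"
| weakly_isolated:
    "buildable V E \<Longrightarrow> x \<notin> V \<Longrightarrow> max_degree_vertex V E w \<Longrightarrow>
     buildable (insert x V) (E \<union> {{x, w}})"
| semi_joined_P4:
    "buildable V E \<Longrightarrow> distinct [a, b, c, d] \<Longrightarrow> {a, b, c, d} \<inter> V = {} \<Longrightarrow>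
     buildable (V \<union> {a, b, c, d})
       (E \<union> {{a, b}, {b, c}, {c, d}} \<union> {{x, u} | x u. x \<in> {b, c} \<and> u \<in> V})"

end

theory Submission
  imports Defs
begin

text \<open>
  The proof rests on a form of the Erdos-Gallai differences that mentions no ordering of the
  vertices. For a set \<open>B\<close> of \<open>k\<close> vertices let the slack of \<open>B\<close> be
  \<open>k (k - 1) + (\<Sum>v\<in>V - B. min k (d v)) - (\<Sum>v\<in>B. d v)\<close>. Exchanging a member of \<open>B\<close> for a
  vertex of at least the same degree does not increase the slack, so \<open>\<Delta>\<^sub>k\<close> is the
  minimum of the slack over all sets of size \<open>k\<close>. Hence a graph is weakly threshold if and only if
  for each \<open>k\<close> up to \<open>m(d)\<close> some \<open>k\<close>-set has slack at most 1
  (\<open>weakly_threshold_sequence_iff_small_slack\<close>).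

  In this form each operation can be followed by hand: a set \<open>B\<close> in the old graph corresponds to
  \<open>B\<close>, extended by the new vertices of high degree, in the new one, and the slack is unchanged.
  The exception is the weakly dominating vertex, where the slack grows by 1 if \<open>k\<close> is
  below the minimum degree. A minimising set may be assumed to
  contain chosen vertices of maximum degree and to avoid chosen vertices of minimum degree
  (\<open>small_slack_between\<close>), which allows passing in both directions. This gives that buildable
  graphs are weakly threshold (\<open>buildable_imp_small_slack\<close>), and that the deletions used below
  keep a graph weakly threshold.

  For the converse (\<open>small_slack_imp_buildable\<close>), take a weakly threshold graph on \<open>n \<ge> 2\<close>
  vertices. An isolated or a dominating vertex can be deleted, so assume there is none. Then
  \<open>\<Delta>\<^sub>1 \<le> 1\<close> yields a vertex of degree \<open>n - 2\<close>, and \<open>\<Delta>\<^sub>2 \<le> 1\<close> yields a vertex of degree 1: if all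
  degrees were between 2 and \<open>n - 2\<close>, each of two vertices of largest degree would contribute a
  non-neighbour to \<open>\<Delta>\<^sub>2\<close>. How the leaves hang on the vertices of degree \<open>n - 2\<close> decides
  whether a weakly dominating vertex, a weakly isolated vertex or a semi-joined \<open>P\<^sub>4\<close> can be
  taken off; in the last case nothing else may be left, and the graph is \<open>P\<^sub>4\<close> itself
  (\<open>buildable_without_extreme_vertices\<close>).
\<close>

section \<open>The slack of a vertex set\<close>

text \<open>
  The number \<open>EG_diff d k\<close> with the sum over the first \<open>k\<close> positions replaced by the sum over
  an arbitrary set \<open>B\<close> of \<open>k\<close> vertices. Since \<open>d\<close> is an arbitrary function, the effect of a
  graph operation is computed on degrees alone.
\<close>

definition slack :: "'a set \<Rightarrow> ('a \<Rightarrow> nat) \<Rightarrow> 'a set \<Rightarrow> int" where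
  "slack V d B =
     int (card B) * (int (card B) - 1) + (\<Sum>v\<in>V - B. int (min (card B) (d v)))
     - (\<Sum>v\<in>B. int (d v))"

text \<open>
  For \<open>k \<ge> 1\<close> the premise says that at least \<open>k\<close> vertices have degree at least \<open>k - 1\<close>, that is,
  \<open>k \<le> m(d)\<close>; for \<open>k = 0\<close> the empty set always works. The empty vertex set satisfies the
  predicate, so the base graphs can be treated as extensions of the empty graph.
\<close>

definition small_slack :: "'a set \<Rightarrow> ('a \<Rightarrow> nat) \<Rightarrow> bool" where
  "small_slack V d \<longleftrightarrow>
     (\<forall>k. k \<le> card {v \<in> V. k \<le> Suc (d v)} \<longrightarrow>
          (\<exists>B\<subseteq>V. card B = k \<and> slack V d B \<le> 1))"

lemma small_slackI:
  assumes "\<And>k. k \<le> card {v \<in> V. k \<le> Suc (d v)} \<Longrightarrow>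
    \<exists>B\<subseteq>V. card B = k \<and> slack V d B \<le> 1"
  shows "small_slack V d"
  using assms by (auto simp: small_slack_def)

lemma small_slackD:
  assumes "small_slack V d" "k \<le> card {v \<in> V. k \<le> Suc (d v)}"
  obtains B where "B \<subseteq> V" "card B = k" "slack V d B \<le> 1"
  using assms by (auto simp: small_slack_def)

lemma slack_empty [simp]: "slack V d {} = 0"
  by (simp add: slack_def)

text \<open>
  Moving \<open>v\<close> in and \<open>u\<close> out leaves the size of \<open>B\<close> and all other summands alone. The outer sum
  changes from \<open>min k (d v)\<close> to \<open>min k (d u)\<close> and the subtracted sum from \<open>d u\<close> to \<open>d v\<close>, and both
  changes lower the slack.
\<close>

lemma slack_exchange:
  assumes V: "finite V" "B \<subseteq> V" and u: "u \<in> B" and v: "v \<in> V - B" and le: "d u \<le> d v"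
  shows "slack V d (insert v (B - {u})) \<le> slack V d B"
proof -
  define C A where "C = B - {u}" and "A = V - B - {v}"
  have fin: "finite C" "finite A" using V finite_subset by (auto simp: C_def A_def)
  have nin: "u \<notin> C" "v \<notin> C" "u \<notin> A" "v \<notin> A" using u v by (auto simp: C_def A_def)
  have B: "B = insert u C" using u by (auto simp: C_def)
  have VB: "V - insert u C = insert v A" "V - insert v C = insert u A"
    using u v V by (auto simp: C_def A_def)
  show ?thesis
    unfolding C_def[symmetric] unfolding B slack_def VB
    using fin nin le by (simp add: card_insert_if)
qed

text \<open>
  Here \<open>P\<close> consists of vertices of top degree and \<open>V - Q\<close> of vertices of bottom degree. Exchanges
  bring the members of \<open>P\<close> into \<open>B\<close> and then drive the non-members of \<open>Q\<close> out of it, and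
  the number of misplaced vertices goes down each time.
\<close>

lemma slack_exchange_between:
  assumes fin: "finite V" and B: "B \<subseteq> V" "slack V d B \<le> c"
    and PQ: "P \<subseteq> Q" "Q \<subseteq> V" "card P \<le> card B" "card B \<le> card Q"
    and top: "\<And>p v. p \<in> P \<Longrightarrow> v \<in> V - P \<Longrightarrow> d v \<le> d p"
    and bot: "\<And>q v. q \<in> Q \<Longrightarrow> v \<in> V - Q \<Longrightarrow> d v \<le> d q"
  obtains C where "P \<subseteq> C" "C \<subseteq> Q" "card C = card B" "slack V d C \<le> c"
proof -
  have "\<exists>C. P \<subseteq> C \<and> C \<subseteq> Q \<and> card C = card B \<and> slack V d C \<le> c"
    using B PQ(3,4)
  proof (induction "card (P - B) + card (B - Q)" arbitrary: B rule: less_induct)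
    case less
    note finB = finite_subset[OF less.prems(1) fin]
    have finQ: "finite Q" using PQ fin finite_subset by auto
    have finP: "finite P" using PQ finQ finite_subset by auto
    have step: ?case
      if uv: "u \<in> B" "v \<in> V - B" "d u \<le> d v"
        and meas: "card (P - insert v (B - {u})) + card (insert v (B - {u}) - Q)
                   < card (P - B) + card (B - Q)" for u v
    proof -
      let ?B = "insert v (B - {u})"
      have card: "card ?B = card B" using uv finB
        by (metis DiffD2 Diff_iff card.remove card_insert_disjoint finite_Diff)
      have "slack V d ?B \<le> c"
        using slack_exchange[OF fin less.prems(1) uv] less.prems(2) by linarith
      with less.hyps[OF meas] card less.prems uv show ?thesis by auto
    qed
    show ?case
    proof (cases "P \<subseteq> B")
      case False
      then obtain p where p: "p \<in> P" "p \<notin> B" by auto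
      have "\<not> B \<subseteq> P"
        using p less.prems(3) finP by (metis card_mono card_subset_eq le_antisym)
      then obtain u where u: "u \<in> B" "u \<notin> P" by auto
      have "P - insert p (B - {u}) = (P - B) - {p}" using p u by auto
      then have "card (P - insert p (B - {u})) < card (P - B)"
        using p finP by (metis DiffI card_Diff1_less finite_Diff)
      moreover have "card (insert p (B - {u}) - Q) \<le> card (B - Q)"
        using p PQ finB by (intro card_mono) auto
      ultimately show ?thesis
        using step[of u p] u p top[of p u] less.prems(1) PQ by auto
    next
      case True
      show ?thesis
      proof (cases "B \<subseteq> Q")
        case False
        then obtain b where b: "b \<in> B" "b \<notin> Q" by auto
        have "\<not> Q \<subseteq> B"
          using b less.prems(4) finB by (metis card_mono card_subset_eq le_antisym)
        then obtain q where q: "q \<in> Q" "q \<notin> B" by auto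
        have "insert q (B - {b}) - Q = (B - Q) - {b}" using q b by auto
        then have "card (insert q (B - {b}) - Q) < card (B - Q)"
          using b finB by (metis DiffI card_Diff1_less finite_Diff)
        moreover have "card (P - insert q (B - {b})) \<le> card (P - B)"
          using b PQ finP by (intro card_mono) auto
        ultimately show ?thesis
          using step[of b q] b q bot[of q b] less.prems(1) PQ by auto
      qed (use True less.prems in auto)
    qed
  qed
  then show ?thesis using that by blast
qed

text \<open>
  This is how deletions use the hypothesis on the larger graph: the set with small slack may be
  assumed to contain the deleted vertices of high degree and to avoid those of low degree, so that
  its trace on the smaller graph has the right size.
\<close>

lemma small_slack_between:
  assumes fin: "finite V" and ss: "small_slack V d" and k: "k \<le> card {v \<in> V. k \<le> Suc (d v)}"
    and PQ: "P \<subseteq> Q" "Q \<subseteq> V" "card P \<le> k" "k \<le> card Q"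
    and top: "\<And>p v. p \<in> P \<Longrightarrow> v \<in> V - P \<Longrightarrow> d v \<le> d p"
    and bot: "\<And>q v. q \<in> Q \<Longrightarrow> v \<in> V - Q \<Longrightarrow> d v \<le> d q"
  obtains C where "P \<subseteq> C" "C \<subseteq> Q" "card C = k" "slack V d C \<le> 1"
proof -
  obtain B where "B \<subseteq> V" "card B = k" "slack V d B \<le> 1"
    using small_slackD[OF ss k] .
  with slack_exchange_between[OF fin this(1,3) PQ(1,2) _ _ top bot] PQ that show ?thesis
    by metis
qed

section \<open>The effect of the operations on the slack\<close>

lemma slack_add_dominating:
  assumes "finite V" "x \<notin> V" "B \<subseteq> V" "d' x = card V" "\<And>v. v \<in> V \<Longrightarrow> d' v = Suc (d v)"
  shows "slack (insert x V) d' (insert x B) = slack V d B"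
proof -
  have fB: "finite B" and x: "x \<notin> B" using assms finite_subset by auto
  have VB: "insert x V - insert x B = V - B" using assms by auto
  have 1: "(\<Sum>v\<in>V - B. int (min (Suc (card B)) (d' v)))
      = (\<Sum>v\<in>V - B. int (min (card B) (d v)) + 1)"
    using assms by (intro sum.cong) auto
  have 2: "(\<Sum>v\<in>B. int (d' v)) = (\<Sum>v\<in>B. int (d v) + 1)"
    using assms by (intro sum.cong) auto
  have 3: "int (card (V - B)) = int (card V) - int (card B)"
    using assms fB by (simp add: card_Diff_subset card_mono)
  show ?thesis unfolding slack_def VB using fB x assms(4)
    by (simp add: 1 2 3 sum.distrib algebra_simps)
qed

lemma slack_add_isolated:
  assumes "finite V" "x \<notin> V" "B \<subseteq> V" "d' x = 0" "\<And>v. v \<in> V \<Longrightarrow> d' v = d v"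
  shows "slack (insert x V) d' B = slack V d B"
proof -
  have VB: "insert x V - B = insert x (V - B)" using assms by auto
  have 1: "(\<Sum>v\<in>V - B. int (min (card B) (d' v))) = (\<Sum>v\<in>V - B. int (min (card B) (d v)))"
    using assms by (intro sum.cong) auto
  have 2: "(\<Sum>v\<in>B. int (d' v)) = (\<Sum>v\<in>B. int (d v))"
    using assms by (intro sum.cong) auto
  show ?thesis unfolding slack_def VB using assms by (simp add: 1 2)
qed

text \<open>
  Compared with a dominating vertex, the new degree is one lower, which costs 1, and the term of
  \<open>w\<close> is \<open>min (k + 1) (d w)\<close> instead of \<open>min (k + 1) (d w + 1)\<close>, which gives the 1 back unless
  \<open>k < d w\<close>.
\<close>

lemma slack_add_weakly_dominating:
  assumes "finite V" "x \<notin> V" "B \<subseteq> V" "w \<in> V" "w \<notin> B"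
    "d' x = card V - 1" "d' w = d w" "\<And>v. v \<in> V - {w} \<Longrightarrow> d' v = Suc (d v)"
  shows "slack (insert x V) d' (insert x B) = slack V d B + of_bool (card B < d w)"
proof -
  define A where "A = V - B - {w}"
  have fB: "finite B" and x: "x \<notin> B" using assms finite_subset by auto
  have VB: "insert x V - insert x B = insert w A" "V - B = insert w A"
    and A: "w \<notin> A" "finite A" using assms by (auto simp: A_def)
  have 1: "(\<Sum>v\<in>A. int (min (Suc (card B)) (d' v)))
      = (\<Sum>v\<in>A. int (min (card B) (d v)) + 1)"
    using assms by (intro sum.cong) (auto simp: A_def)
  have "d' v = Suc (d v)" if "v \<in> B" for v
    using that assms(3,5,8) by (metis DiffI singletonD subsetD)
  then have 2: "(\<Sum>v\<in>B. int (d' v)) = (\<Sum>v\<in>B. int (d v) + 1)"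
    by (simp add: add.commute)
  have "card V = card B + card (insert w A)"
    using assms fB VB(2) by (metis card_Diff_subset card_mono le_add_diff_inverse)
  then have 3: "card V = card B + card A + 1" using A by simp
  show ?thesis unfolding slack_def VB using fB x A assms(6,7)
    by (simp add: 1 2 3 sum.distrib algebra_simps)
qed

lemma slack_add_weakly_isolated:
  assumes "finite V" "x \<notin> V" "B \<subseteq> V" "w \<in> B"
    "d' x = 1" "d' w = Suc (d w)" "\<And>v. v \<in> V - {w} \<Longrightarrow> d' v = d v"
  shows "slack (insert x V) d' B = slack V d B"
proof -
  define C where "C = B - {w}"
  have C: "B = insert w C" "w \<notin> C" "finite C" using assms finite_subset by (auto simp: C_def)
  have VB: "insert x V - B = insert x (V - B)" using assms by auto
  have "d' v = d v" if "v \<in> V - B" for v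
    using that assms(4,7) by (metis Diff_iff singletonD)
  then have 1: "(\<Sum>v\<in>V - B. int (min (card B) (d' v))) = (\<Sum>v\<in>V - B. int (min (card B) (d v)))"
    by simp
  have 2: "(\<Sum>v\<in>C. int (d' v)) = (\<Sum>v\<in>C. int (d v))"
    using assms by (intro sum.cong refl) (auto simp: C_def)
  have 3: "(\<Sum>v\<in>B. int (d' v)) = (\<Sum>v\<in>B. int (d v)) + 1"
    using C 2 assms by simp
  have "card B \<ge> 1" using C by simp
  then show ?thesis unfolding slack_def VB using assms by (simp add: 1 3)
qed

lemma slack_add_semi_joined_P4:
  assumes "finite V" "distinct [a, b, c, e]" "{a, b, c, e} \<inter> V = {}" "B \<subseteq> V"
    "d' a = 1" "d' e = 1" "d' b = card V + 2" "d' c = card V + 2"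
    "\<And>v. v \<in> V \<Longrightarrow> d' v = d v + 2"
  shows "slack (V \<union> {a, b, c, e}) d' (B \<union> {b, c}) = slack V d B"
proof -
  have fB: "finite B" and x: "b \<notin> B" "c \<notin> B" using assms finite_subset by auto
  have VB: "V \<union> {a, b, c, e} - (insert b (insert c B)) = insert a (insert e (V - B))"
    and BB: "B \<union> {b, c} = insert b (insert c B)" using assms by auto
  have 1: "(\<Sum>v\<in>V - B. int (min (Suc (Suc (card B))) (d' v)))
      = (\<Sum>v\<in>V - B. int (min (card B) (d v)) + 2)"
    using assms by (intro sum.cong) auto
  have 2: "(\<Sum>v\<in>B. int (d' v)) = (\<Sum>v\<in>B. int (d v) + 2)"
    using assms by (intro sum.cong) auto
  have 3: "int (card (V - B)) = int (card V) - int (card B)"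
    using assms fB by (simp add: card_Diff_subset card_mono)
  show ?thesis unfolding slack_def BB VB using fB x assms(1-3,5-8)
    by (simp add: 1 2 3 sum.distrib algebra_simps)
qed

section \<open>The operations preserve and reflect small slack\<close>

text \<open>
  A new vertex raises the index bound \<open>m\<close> by at most one as long as each old degree grows by at most one.
\<close>

lemma count_delete_vertex:
  assumes "finite V" "Suc k \<le> card {v \<in> insert x V. Suc k \<le> Suc (d' v)}"
    "\<And>v. v \<in> V \<Longrightarrow> d' v \<le> Suc (d v)"
  shows "k \<le> card {v \<in> V. k \<le> Suc (d v)}"
proof -
  have "Suc k \<le> card (insert x {v \<in> V. k \<le> Suc (d v)})"
  proof (rule order_trans[OF assms(2) card_mono])
    show "{v \<in> insert x V. Suc k \<le> Suc (d' v)} \<subseteq> insert x {v \<in> V. k \<le> Suc (d v)}"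
      using assms(3) le_trans by fastforce
  qed (use assms(1) in simp)
  also have "\<dots> \<le> Suc (card {v \<in> V. k \<le> Suc (d v)})"
    by (rule card_insert_le_m1) auto
  finally show ?thesis by simp
qed

lemma count_insert_vertex:
  assumes "finite V" "x \<notin> V" "S \<subseteq> V" "k \<le> card S" "k \<le> d' x"
    "\<And>v. v \<in> S \<Longrightarrow> k \<le> d' v"
  shows "Suc k \<le> card {v \<in> insert x V. Suc k \<le> Suc (d' v)}"
proof -
  have "finite S" "x \<notin> S" using assms finite_subset by auto
  then have "Suc k \<le> card (insert x S)" using assms(4) by simp
  also have "\<dots> \<le> card {v \<in> insert x V. Suc k \<le> Suc (d' v)}"
    using assms by (intro card_mono) auto
  finally show ?thesis .
qed

lemma count_le_card: "finite V \<Longrightarrow> k \<le> card {v \<in> V. P v} \<Longrightarrow> k \<le> card V"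
  by (rule order_trans[OF _ card_mono]) auto

lemma small_slack_dominating_iff:
  assumes fin: "finite V" and x: "x \<notin> V" and bound: "\<And>v. v \<in> V \<Longrightarrow> d v < card V"
    and dx: "d' x = card V" and dv: "\<And>v. v \<in> V \<Longrightarrow> d' v = Suc (d v)"
  shows "small_slack (insert x V) d' \<longleftrightarrow> small_slack V d"
proof
  assume ss: "small_slack V d"
  show "small_slack (insert x V) d'"
  proof (rule small_slackI)
    fix k assume k: "k \<le> card {v \<in> insert x V. k \<le> Suc (d' v)}"
    show "\<exists>B\<subseteq>insert x V. card B = k \<and> slack (insert x V) d' B \<le> 1"
    proof (cases k)
      case 0 then show ?thesis by (intro exI[of _ "{}"]) auto
    next
      case (Suc j)
      have "j \<le> card {v \<in> V. j \<le> Suc (d v)}"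
        using count_delete_vertex[OF fin k[unfolded Suc]] dv by simp
      then obtain B where B: "B \<subseteq> V" "card B = j" "slack V d B \<le> 1" using small_slackD[OF ss] by blast
      then have "slack (insert x V) d' (insert x B) \<le> 1"
        using slack_add_dominating[where d' = d' and d = d, OF fin x B(1) dx dv] by simp
      moreover have "card (insert x B) = k"
        using B x fin Suc finite_subset by (metis card_insert_disjoint subsetD)
      ultimately show ?thesis using B by (intro exI[of _ "insert x B"]) auto
    qed
  qed
next
  assume ss: "small_slack (insert x V) d'"
  show "small_slack V d"
  proof (rule small_slackI)
    fix k assume k: "k \<le> card {v \<in> V. k \<le> Suc (d v)}"
    have kV: "k \<le> card V" using count_le_card[OF fin k] .
    have k': "Suc k \<le> card {v \<in> insert x V. Suc k \<le> Suc (d' v)}"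
      using count_insert_vertex[OF fin x _ k, of d'] dx dv kV by auto
    obtain C where C: "{x} \<subseteq> C" "C \<subseteq> insert x V" "card C = Suc k" "slack (insert x V) d' C \<le> 1"
      by (rule small_slack_between[OF _ ss k', of "{x}" "insert x V"])
        (use fin kV x dx dv bound in \<open>auto simp: Suc_le_eq\<close>)
    define B where "B = C - {x}"
    have B: "C = insert x B" "x \<notin> B" "B \<subseteq> V" using C by (auto simp: B_def)
    then have "card B = k" using C fin finite_subset by (metis B_def card_Diff_singleton diff_Suc_1 insertI1)
    moreover have "slack V d B \<le> 1"
      using slack_add_dominating[where d' = d' and d = d, OF fin x B(3) dx dv] C(4) B(1) by simp
    ultimately show "\<exists>B\<subseteq>V. card B = k \<and> slack V d B \<le> 1" using B by auto
  qed
qed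

lemma small_slack_isolated_iff:
  assumes fin: "finite V" and x: "x \<notin> V" and ne: "V \<noteq> {}"
    and dx: "d' x = 0" and dv: "\<And>v. v \<in> V \<Longrightarrow> d' v = d v"
  shows "small_slack (insert x V) d' \<longleftrightarrow> small_slack V d"
proof -
  have count: "k \<le> card {v \<in> insert x V. k \<le> Suc (d' v)} \<longleftrightarrow> k \<le> card {v \<in> V. k \<le> Suc (d v)}" for k
  proof (cases "k \<le> 1")
    case True
    then have "{v \<in> V. k \<le> Suc (d v)} = V" "{v \<in> insert x V. k \<le> Suc (d' v)} = insert x V" by auto
    moreover have "card V \<ge> 1" using ne fin by (metis One_nat_def Suc_leI card_gt_0_iff empty_iff)
    ultimately show ?thesis using True fin x by simp
  next
    case False
    then have "{v \<in> insert x V. k \<le> Suc (d' v)} = {v \<in> V. k \<le> Suc (d v)}"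
      using dx dv by auto
    then show ?thesis by simp
  qed
  show ?thesis
  proof
    assume ss: "small_slack V d"
    show "small_slack (insert x V) d'"
    proof (rule small_slackI)
      fix k assume "k \<le> card {v \<in> insert x V. k \<le> Suc (d' v)}"
      then have "k \<le> card {v \<in> V. k \<le> Suc (d v)}" using count by simp
      then obtain B where "B \<subseteq> V" "card B = k" "slack V d B \<le> 1"
        using small_slackD[OF ss] by blast
      then show "\<exists>B\<subseteq>insert x V. card B = k \<and> slack (insert x V) d' B \<le> 1"
        using slack_add_isolated[where d' = d' and d = d, OF fin x _ dx dv] by (intro exI[of _ B]) auto
    qed
  next
    assume ss: "small_slack (insert x V) d'"
    show "small_slack V d"
    proof (rule small_slackI)
      fix k assume k: "k \<le> card {v \<in> V. k \<le> Suc (d v)}"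
      then have k': "k \<le> card {v \<in> insert x V. k \<le> Suc (d' v)}" using count by simp
      obtain B where B: "B \<subseteq> V" "card B = k" "slack (insert x V) d' B \<le> 1"
      proof (rule small_slack_between[OF _ ss k', of "{}" V])
        show "d' v \<le> d' q" if "v \<in> insert x V - V" for q v using that dx by auto
      qed (use fin count_le_card[OF fin k] in auto)
      then show "\<exists>B\<subseteq>V. card B = k \<and> slack V d B \<le> 1"
        using slack_add_isolated[where d' = d' and d = d, OF fin x B(1) dx dv] by auto
    qed
  qed
qed

text \<open>
  The delicate case is \<open>k < d w\<close>, where the new vertex adds 1 to the slack. Then
  every vertex has degree above \<open>k\<close>, so the slack of a set of at most \<open>k + 1\<close> vertices is the sum
  of the deficits \<open>card V - 1 - d v\<close> over it. The hypothesis for \<open>k + 1\<close> bounds the total deficit of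
  \<open>k + 1\<close> vertices by 1, so after a vertex of largest deficit is dropped the other \<open>k\<close> are
  dominating, with slack 0, and the extra 1 is harmless.
\<close>

lemma small_slack_add_weakly_dominating:
  assumes fin: "finite V" and x: "x \<notin> V" and w: "w \<in> V"
    and bound: "\<And>v. v \<in> V \<Longrightarrow> d v < card V" and min: "\<And>v. v \<in> V \<Longrightarrow> d w \<le> d v"
    and dx: "d' x = card V - 1" and dw: "d' w = d w"
    and dv: "\<And>v. v \<in> V - {w} \<Longrightarrow> d' v = Suc (d v)"
    and ss: "small_slack V d"
  shows "small_slack (insert x V) d'"
proof (rule small_slackI)
  fix k' assume k': "k' \<le> card {v \<in> insert x V. k' \<le> Suc (d' v)}"
  have dv_le: "d' v \<le> Suc (d v)" if "v \<in> V" for v using that dw dv by (cases "v = w") auto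
  show "\<exists>B\<subseteq>insert x V. card B = k' \<and> slack (insert x V) d' B \<le> 1"
  proof (cases k')
    case 0 then show ?thesis by (intro exI[of _ "{}"]) auto
  next
    case (Suc k)
    have k: "k \<le> card {v \<in> V. k \<le> Suc (d v)}"
      using count_delete_vertex[OF fin k'[unfolded Suc]] dv_le by simp
    have "k < card V"
    proof (rule ccontr)
      assume "\<not> k < card V"
      moreover have "card V \<ge> 1" using w fin by (metis One_nat_def Suc_leI card_gt_0_iff empty_iff)
      ultimately have "{v \<in> insert x V. k' \<le> Suc (d' v)} = {v \<in> V. k' \<le> Suc (d' v)}"
        using dx Suc by auto
      then have "k' \<le> card V" using count_le_card[OF fin, of k'] k' by simp
      then show False using Suc \<open>\<not> k < card V\<close> by simp
    qed
    have "\<exists>B\<subseteq>V - {w}. card B = k \<and> slack V d B + of_bool (k < d w) \<le> 1"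
    proof (cases "k < d w")
      case False
      have cw: "k \<le> card (V - {w})" using \<open>k < card V\<close> w fin by simp
      obtain B where "B \<subseteq> V - {w}" "card B = k" "slack V d B \<le> 1"
        by (rule small_slack_between[OF fin ss k, of "{}" "V - {w}"]) (use min cw in auto)
      then show ?thesis using False by auto
    next
      case True
      have all: "Suc k \<le> d v" if "v \<in> V" for v using min[OF that] True by simp
      have "k \<le> d v" if "v \<in> V" for v using all[OF that] by simp
      then have "{v \<in> V. Suc k \<le> Suc (d v)} = V" by auto
      then obtain C where C: "C \<subseteq> V" "card C = Suc k" "slack V d C \<le> 1"
        using small_slackD[OF ss, of "Suc k"] \<open>k < card V\<close> by auto
      have finC: "finite C" using C fin finite_subset by auto
      have deficit: "slack V d B = (\<Sum>v\<in>B. int (card V) - 1 - int (d v))"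
        if B: "B \<subseteq> V" "card B \<le> Suc k" for B
      proof -
        have "(\<Sum>v\<in>V - B. int (min (card B) (d v))) = (\<Sum>v\<in>V - B. int (card B))"
          using all B(2) by (intro sum.cong refl) (force simp: min_def)
        moreover have "int (card (V - B)) = int (card V) - int (card B)"
          using B fin finite_subset by (subst card_Diff_subset) (auto simp: card_mono of_nat_diff)
        moreover have "(\<Sum>v\<in>B. int (card V) - 1 - int (d v))
            = int (card B) * (int (card V) - 1) - (\<Sum>v\<in>B. int (d v))"
          by (simp add: sum_subtractf)
        ultimately show ?thesis by (simp add: slack_def algebra_simps)
      qed
      \<comment> \<open>If \<open>w\<close> belongs to \<open>C\<close>, it must be the vertex to drop, as the new set has to avoid it.\<close>
      obtain c where c: "c \<in> C" "\<And>v. v \<in> C \<Longrightarrow> d c \<le> d v" "w \<in> C \<Longrightarrow> c = w"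
      proof (cases "w \<in> C")
        case True
        then show ?thesis by (rule that) (use min C(1) in auto)
      next
        case False
        have ne: "C \<noteq> {}" using C by auto
        show ?thesis
          by (rule that[OF arg_min_if_finite(1)[OF finC ne] arg_min_least[OF finC ne]])
            (use False in auto)
      qed
      define B where "B = C - {c}"
      have B: "B \<subseteq> V - {w}" "card B = k" using c C finC by (auto simp: B_def)
      have dominating: "d v = card V - 1" if "v \<in> B" for v
      proof (rule ccontr)
        assume neq: "d v \<noteq> card V - 1"
        have v: "v \<in> C" "v \<noteq> c" using that by (auto simp: B_def)
        then have "v \<in> V" using C(1) by auto
        then have "d v + 2 \<le> card V" using bound[of v] neq by simp
        then have "(\<Sum>u\<in>{v, c}. int (card V) - 1 - int (d u)) \<ge> 2"
          using v c(2)[OF v(1)] by auto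
        also have "(\<Sum>u\<in>{v, c}. int (card V) - 1 - int (d u))
            \<le> (\<Sum>u\<in>C. int (card V) - 1 - int (d u))"
        proof (rule sum_mono2[OF finC])
          show "0 \<le> int (card V) - 1 - int (d u)" if "u \<in> C - {v, c}" for u
            using that bound[of u] C(1) by auto
        qed (use v c in auto)
        also have "\<dots> = slack V d C" using deficit[of C] C by simp
        finally show False using C by simp
      qed
      have "slack V d B = 0"
      proof -
        have "int (d v) = int (card V) - 1" if "v \<in> B" for v
          using dominating[OF that] \<open>k < card V\<close> by simp
        then show ?thesis using deficit[of B] B by auto
      qed
      then show ?thesis using B by (intro exI[of _ B]) simp
    qed
    then obtain B where B: "B \<subseteq> V - {w}" "card B = k" "slack V d B + of_bool (k < d w) \<le> 1" by auto
    have "B \<subseteq> V" "w \<notin> B" using B by auto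
    then have "slack (insert x V) d' (insert x B) \<le> 1"
      using slack_add_weakly_dominating[where d' = d' and d = d, OF fin x _ w _ dx dw dv, of B] B by simp
    moreover have "card (insert x B) = k'"
      using B x fin Suc by (metis Diff_subset card_insert_disjoint finite_subset subsetD)
    ultimately show ?thesis using B by (intro exI[of _ "insert x B"]) auto
  qed
qed

text \<open>
  Since \<open>x\<close> has maximum and \<open>w\<close> minimum degree after the addition, a set with small slack
  may be taken to contain \<open>x\<close> and to avoid \<open>w\<close>. This works unless \<open>k = card V\<close>;
  in that case the old graph is complete and, \<open>x\<close> having maximum degree, consists of \<open>w\<close> alone.
\<close>

lemma small_slack_delete_weakly_dominating:
  assumes fin: "finite V" and x: "x \<notin> V" and w: "w \<in> V"
    and bound: "\<And>v. v \<in> V \<Longrightarrow> d v < card V" and min: "\<And>v. v \<in> V \<Longrightarrow> d w \<le> d v"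
    and dx: "d' x = card V - 1" and dw: "d' w = d w"
    and dv: "\<And>v. v \<in> V - {w} \<Longrightarrow> d' v = Suc (d v)"
    and max: "\<And>v. v \<in> V \<Longrightarrow> d' v \<le> d' x"
    and ss: "small_slack (insert x V) d'"
  shows "small_slack V d"
proof (rule small_slackI)
  fix k assume k: "k \<le> card {v \<in> V. k \<le> Suc (d v)}"
  have kV: "k \<le> card V" using count_le_card[OF fin k] .
  show "\<exists>B\<subseteq>V. card B = k \<and> slack V d B \<le> 1"
  proof (cases "k = card V")
    case True
    have all: "k \<le> Suc (d v)" if "v \<in> V" for v
    proof -
      have "{v \<in> V. k \<le> Suc (d v)} = V"
        using k True fin by (intro card_seteq) auto
      then show ?thesis using that by blast
    qed
    \<comment> \<open>A second vertex would be dominating and have degree above \<open>d' x\<close>.\<close>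
    have "V = {w}"
    proof (rule ccontr)
      assume "V \<noteq> {w}"
      then obtain v where v: "v \<in> V" "v \<noteq> w" using w by auto
      then have "card V \<ge> 1" using fin by (metis One_nat_def Suc_leI card_gt_0_iff empty_iff)
      then show False using all[of v] max[of v] dv[of v] v dx True by simp
    qed
    moreover have "d w = 0" using bound[OF w] \<open>V = {w}\<close> by simp
    ultimately show ?thesis using True by (intro exI[of _ V]) (simp add: slack_def)
  next
    case False
    then have cw: "k \<le> card (V - {w})" using kV w fin by simp
    define S where "S = {v \<in> V - {w}. k \<le> Suc (d v)}"
    have "k \<le> card S"
    proof (cases "k \<le> Suc (d w)")
      case True
      then have "S = V - {w}" using min by (force simp: S_def)
      then show ?thesis using cw by simp
    next
      case False
      then have "S = {v \<in> V. k \<le> Suc (d v)}" by (auto simp: S_def)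
      then show ?thesis using k by simp
    qed
    then have k': "Suc k \<le> card {v \<in> insert x V. Suc k \<le> Suc (d' v)}"
      using count_insert_vertex[OF fin x, of S k d'] cw dx w fin dv by (auto simp: S_def)
    obtain C where C: "{x} \<subseteq> C" "C \<subseteq> insert x V - {w}" "card C = Suc k" "slack (insert x V) d' C \<le> 1"
    proof (rule small_slack_between[OF _ ss k', of "{x}" "insert x V - {w}"])
      show "Suc k \<le> card (insert x V - {w})"
      proof -
        have "insert x V - {w} = insert x (V - {w})" using x w by auto
        then show ?thesis using cw x fin by simp
      qed
      show "d' v \<le> d' q" if "q \<in> insert x V - {w}" "v \<in> insert x V - (insert x V - {w})" for q v
      proof -
        have "v = w" using that by auto
        then show ?thesis using that max[OF w] min[of q] dv[of q] dw by auto
      qed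
    qed (use fin x w max in auto)
    define B where "B = C - {x}"
    have B: "C = insert x B" "x \<notin> B" "B \<subseteq> V - {w}" using C by (auto simp: B_def)
    then have "card B = k" using C fin finite_subset by (metis B_def card_Diff_singleton diff_Suc_1 insertI1)
    moreover have "B \<subseteq> V" "w \<notin> B" using B by auto
    then have "slack V d B + of_bool (card B < d w) \<le> 1"
      using slack_add_weakly_dominating[where d' = d' and d = d, OF fin x _ w _ dx dw dv, of B] C(4) B(1) by simp
    then have "slack V d B \<le> 1" by (cases "card B < d w") auto
    ultimately show ?thesis using B by auto
  qed
qed

text \<open>
  A set that contains \<open>w\<close> keeps its slack, and \<open>w\<close> can be put into it because its degree is
  maximal. The bound \<open>m\<close> stays the same except when \<open>w\<close> alone may have positive degree: then
  \<open>k = 2\<close> becomes relevant, and the pair \<open>{w, x}\<close> serves.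
\<close>

lemma small_slack_add_weakly_isolated:
  assumes fin: "finite V" and x: "x \<notin> V" and w: "w \<in> V"
    and max: "\<And>v. v \<in> V \<Longrightarrow> d v \<le> d w"
    and dx: "d' x = 1" and dw: "d' w = Suc (d w)"
    and dv: "\<And>v. v \<in> V - {w} \<Longrightarrow> d' v = d v"
    and ss: "small_slack V d"
  shows "small_slack (insert x V) d'"
proof (rule small_slackI)
  fix k assume k': "k \<le> card {v \<in> insert x V. k \<le> Suc (d' v)}"
  have V1: "card V \<ge> 1" using w fin by (metis One_nat_def Suc_leI card_gt_0_iff empty_iff)
  \<comment> \<open>Only the vertex \<open>w\<close> gains degree, and \<open>x\<close> counts only for \<open>k \<le> 2\<close>.\<close>
  consider "k = 0" | "k \<ge> 1" "k \<le> card {v \<in> V. k \<le> Suc (d v)}"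
    | "k = 2" "\<And>v. v \<in> V - {w} \<Longrightarrow> d v = 0"
  proof -
    have "k \<le> card {v \<in> V. k \<le> Suc (d v)}" if "k \<ge> 3"
    proof -
      have "{v \<in> insert x V. k \<le> Suc (d' v)} \<subseteq> insert w {v \<in> V. k \<le> Suc (d v)}"
        using that dx dv by force
      moreover have "w \<in> {v \<in> V. k \<le> Suc (d v)}"
      proof (rule ccontr)
        assume "w \<notin> {v \<in> V. k \<le> Suc (d v)}"
        then have "{v \<in> V. k \<le> Suc (d v)} = {}" using w max by force
        with calculation have "{v \<in> insert x V. k \<le> Suc (d' v)} \<subseteq> {w}" by auto
        then have "card {v \<in> insert x V. k \<le> Suc (d' v)} \<le> 1"
          by (metis card_mono finite.emptyI finite.insertI is_singletonI is_singleton_altdef)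
        then show False using k' that by simp
      qed
      ultimately have "{v \<in> insert x V. k \<le> Suc (d' v)} \<subseteq> {v \<in> V. k \<le> Suc (d v)}" by auto
      then have "card {v \<in> insert x V. k \<le> Suc (d' v)} \<le> card {v \<in> V. k \<le> Suc (d v)}"
        using fin by (intro card_mono) auto
      then show ?thesis using k' by simp
    qed
    moreover have "k \<le> card {v \<in> V. k \<le> Suc (d v)}" if "k = 1"
      using that V1 by simp
    moreover have "k \<le> card {v \<in> V. k \<le> Suc (d v)}"
      if "k = 2" "v \<in> V - {w}" "d v \<noteq> 0" for v
    proof -
      have "{v, w} \<subseteq> {v \<in> V. k \<le> Suc (d v)}"
        using that w max[of v] by auto
      then have "card {v, w} \<le> card {v \<in> V. k \<le> Suc (d v)}"
        using fin by (intro card_mono) auto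
      then show ?thesis using that by simp
    qed
    ultimately show ?thesis using that by (cases "k \<ge> 3"; cases "k = 2"; cases "k = 1") force+
  qed
  then show "\<exists>B\<subseteq>insert x V. card B = k \<and> slack (insert x V) d' B \<le> 1"
  proof cases
    case 1 then show ?thesis by (intro exI[of _ "{}"]) auto
  next
    case 2
    obtain B where B: "{w} \<subseteq> B" "B \<subseteq> V" "card B = k" "slack V d B \<le> 1"
      by (rule small_slack_between[OF fin ss 2(2), of "{w}" V])
        (use 2 w max count_le_card[OF fin 2(2)] in auto)
    then show ?thesis
      using slack_add_weakly_isolated[OF fin x, of B w d' d] dx dw dv by (intro exI[of _ B]) auto
  next
    case 3
    have "insert x V - {w, x} = V - {w}" using x w by auto
    moreover have "(\<Sum>v\<in>V - {w}. int (min 2 (d' v))) = 0"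
      using 3 dv by (intro sum.neutral) auto
    moreover have "w \<noteq> x" using x w by auto
    ultimately have "slack (insert x V) d' {w, x} \<le> 0"
      using dx dw by (simp add: slack_def numeral_2_eq_2)
    then show ?thesis using x w 3 by (intro exI[of _ "{w, x}"]) (auto simp: card_insert_if)
  qed
qed

lemma small_slack_delete_weakly_isolated:
  assumes fin: "finite V" and x: "x \<notin> V" and w: "w \<in> V"
    and max: "\<And>v. v \<in> V \<Longrightarrow> d v \<le> d w"
    and dx: "d' x = 1" and dw: "d' w = Suc (d w)"
    and dv: "\<And>v. v \<in> V - {w} \<Longrightarrow> d' v = d v"
    and pos: "\<And>v. v \<in> V \<Longrightarrow> 1 \<le> d' v"
    and ss: "small_slack (insert x V) d'"
  shows "small_slack V d"
proof (rule small_slackI)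
  fix k assume k: "k \<le> card {v \<in> V. k \<le> Suc (d v)}"
  show "\<exists>B\<subseteq>V. card B = k \<and> slack V d B \<le> 1"
  proof (cases "k = 0")
    case False
    have le: "d v \<le> d' v" if "v \<in> V" for v using that dw dv by (cases "v = w") auto
    have "k \<le> Suc (d' v)" if "v \<in> V" "k \<le> Suc (d v)" for v using that le[of v] by simp
    then have "card {v \<in> V. k \<le> Suc (d v)} \<le> card {v \<in> insert x V. k \<le> Suc (d' v)}"
      using fin by (intro card_mono) auto
    then have k': "k \<le> card {v \<in> insert x V. k \<le> Suc (d' v)}" using k by simp
    have max': "d' v \<le> d' w" if "v \<in> insert x V" for v
      using that max[of v] dv[of v] dw dx by (cases "v = w") auto
    obtain B where "{w} \<subseteq> B" "B \<subseteq> V" "card B = k" "slack (insert x V) d' B \<le> 1"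
    proof (rule small_slack_between[OF _ ss k', of "{w}" V])
      show "d' v \<le> d' p" if "p \<in> {w}" "v \<in> insert x V - {w}" for p v
        using that max'[of v] by auto
      show "d' v \<le> d' q" if "q \<in> V" "v \<in> insert x V - V" for q v
        using that pos[of q] dx by auto
    qed (use fin count_le_card[OF fin k] w False in auto)
    then show ?thesis
      using slack_add_weakly_isolated[OF fin x, of B w d' d] dx dw dv by (intro exI[of _ B]) auto
  qed (intro exI[of _ "{}"], auto)
qed

text \<open>
  The midpoints \<open>b\<close> and \<open>c\<close> have the largest degrees and the endpoints \<open>a\<close> and \<open>e\<close> the smallest, so
  the index \<open>k\<close> for the old graph corresponds to \<open>k + 2\<close> for the new one. The index 1 of the new
  graph has no counterpart; the set \<open>{b}\<close> has slack exactly 1.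
\<close>

lemma small_slack_semi_joined_P4_iff:
  assumes fin: "finite V" and dist: "distinct [a, b, c, e]" "{a, b, c, e} \<inter> V = {}"
    and bound: "\<And>v. v \<in> V \<Longrightarrow> d v < card V"
    and de: "d' a = 1" "d' e = 1" "d' b = card V + 2" "d' c = card V + 2"
    and dv: "\<And>v. v \<in> V \<Longrightarrow> d' v = d v + 2"
  shows "small_slack (V \<union> {a, b, c, e}) d' \<longleftrightarrow> small_slack V d"
proof
  let ?V = "V \<union> {a, b, c, e}"
  have count: "k + 2 \<le> card {v \<in> ?V. k + 2 \<le> Suc (d' v)} \<longleftrightarrow> k \<le> card {v \<in> V. k \<le> Suc (d v)}"
    if "k \<ge> 1" "k \<le> card V \<or> k + 2 \<le> card {v \<in> ?V. k + 2 \<le> Suc (d' v)}" for k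
  proof -
    have "{v \<in> ?V. k + 2 \<le> Suc (d' v)} \<subseteq> V \<union> {b, c}" using that(1) de by auto
    then have "card {v \<in> ?V. k + 2 \<le> Suc (d' v)} \<le> card (V \<union> {b, c})"
      using fin by (intro card_mono) auto
    also have "\<dots> = card V + 2" using fin dist by simp
    finally have "k \<le> card V" using that(2) by auto
    then have "{v \<in> ?V. k + 2 \<le> Suc (d' v)} = {b, c} \<union> {v \<in> V. k \<le> Suc (d v)}"
      using that(1) de dv by auto
    then show ?thesis using fin dist by simp
  qed
  {
    assume ss: "small_slack V d"
    show "small_slack ?V d'"
    proof (rule small_slackI)
      fix k' assume k': "k' \<le> card {v \<in> ?V. k' \<le> Suc (d' v)}"
      consider "k' = 0" | "k' = 1" | k where "k' = k + 2" by (metis One_nat_def add_2_eq_Suc' not0_implies_Suc)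
      then show "\<exists>B\<subseteq>?V. card B = k' \<and> slack ?V d' B \<le> 1"
      proof cases
        case 1 then show ?thesis by (intro exI[of _ "{}"]) auto
      next
        case 2
        have "?V - {b} = insert a (insert c (insert e V))" using dist by auto
        moreover have "(\<Sum>v\<in>V. int (min 1 (d' v))) = (\<Sum>v\<in>V. 1)"
          using dv by (intro sum.cong) auto
        ultimately have "slack ?V d' {b} = 1"
          using dist fin de by (simp add: slack_def)
        then show ?thesis using 2 by (intro exI[of _ "{b}"]) auto
      next
        case 3
        have "k \<le> card {v \<in> V. k \<le> Suc (d v)}"
          using count[of k] k' 3 by (cases "k = 0") auto
        then obtain B where B: "B \<subseteq> V" "card B = k" "slack V d B \<le> 1" using small_slackD[OF ss] by blast
        then have "slack ?V d' (B \<union> {b, c}) \<le> 1"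
          using slack_add_semi_joined_P4[where d' = d' and d = d, OF fin dist B(1) de dv] by simp
        moreover have "card (B \<union> {b, c}) = k'"
        proof -
          have "b \<notin> B" "c \<notin> B" "finite B" using B dist fin finite_subset by auto
          then show ?thesis using B 3 dist by simp
        qed
        ultimately show ?thesis using B by (intro exI[of _ "B \<union> {b, c}"]) auto
      qed
    qed
  }
  {
    assume ss: "small_slack ?V d'"
    show "small_slack V d"
    proof (rule small_slackI)
      fix k assume k: "k \<le> card {v \<in> V. k \<le> Suc (d v)}"
      have kV: "k \<le> card V" using count_le_card[OF fin k] .
      show "\<exists>B\<subseteq>V. card B = k \<and> slack V d B \<le> 1"
      proof (cases "k = 0")
        case False
        then have k': "k + 2 \<le> card {v \<in> ?V. k + 2 \<le> Suc (d' v)}" using count k kV by simp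
        obtain C where C: "{b, c} \<subseteq> C" "C \<subseteq> V \<union> {b, c}" "card C = k + 2" "slack ?V d' C \<le> 1"
        proof (rule small_slack_between[OF _ ss k', of "{b, c}" "V \<union> {b, c}"])
          show "k + 2 \<le> card (V \<union> {b, c})" using kV dist fin by simp
          show "d' v \<le> d' p" if "p \<in> {b, c}" "v \<in> ?V - {b, c}" for p v
            using that de dv[of v] bound[of v] by auto
          show "d' v \<le> d' q" if "q \<in> V \<union> {b, c}" "v \<in> ?V - (V \<union> {b, c})" for q v
            using that de dv[of q] by auto
        qed (use fin dist in auto)
        define B where "B = C - {b, c}"
        have B: "C = B \<union> {b, c}" "B \<subseteq> V" using C dist by (auto simp: B_def)
        have "card B = k" using C dist by (simp add: B_def card_Diff_subset)
        moreover have "slack V d B \<le> 1"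
          using slack_add_semi_joined_P4[where d' = d' and d = d, OF fin dist B(2) de dv] C(4) B(1) by simp
        ultimately show ?thesis using B by auto
      qed (intro exI[of _ "{}"], auto)
    qed
  }
qed

lemma small_slack_empty: "small_slack {} d"
  by (rule small_slackI) auto

section \<open>Weakly threshold sequences in terms of slack\<close>

lemma degree_sequence_enumeration:
  fixes f :: "'a \<Rightarrow> nat"
  assumes "finite V"
  obtains vs where "distinct vs" "set vs = V" "sorted_wrt (\<lambda>u v. f v \<le> f u) vs"
    "map f vs = rev (sorted_list_of_multiset (image_mset f (mset_set V)))"
proof -
  obtain l where l: "set l = V" "distinct l" using finite_distinct_list[OF assms] by auto
  have "image_mset f (mset_set V) = mset (map f l)"
    using l mset_set_set by fastforce
  then have "sorted_list_of_multiset (image_mset f (mset_set V)) = sort (map f l)"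
    by (simp only: sorted_list_of_multiset_mset)
  also have "\<dots> = map f (sort_key f l)"
    by (rule properties_for_sort) auto
  finally have "map f (rev (sort_key f l)) = rev (sorted_list_of_multiset (image_mset f (mset_set V)))"
    by (simp add: rev_map)
  moreover have "sorted_wrt (\<lambda>u v. f v \<le> f u) (rev (sort_key f l))"
    using sorted_sort_key[of f l] by (simp add: sorted_wrt_rev sorted_map)
  ultimately show ?thesis using that[of "rev (sort_key f l)"] l by simp
qed

lemma EG_diff_eq_slack:
  assumes vs: "distinct vs" and k: "k \<le> length vs"
  shows "EG_diff (map f vs) k = slack (set vs) f (set (take k vs))"
proof -
  have card: "card (set (take k vs)) = k" using vs k by (simp add: distinct_card)
  have "set vs - set (take k vs) = set (drop k vs)"
    using vs set_take_disj_set_drop_if_distinct[OF vs, of k k]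
    by (metis Diff_cancel Diff_triv Un_Diff append_take_drop_id inf_commute order_refl set_append sup_bot_left)
  then have "(\<Sum>v\<in>set vs - set (take k vs). int (min k (f v)))
      = (\<Sum>i = 0..<length vs - k. int (min k (f (vs ! (k + i)))))"
    using vs k by (simp add: sum.distinct_set_conv_list sum_list_sum_nth)
  also have "\<dots> = (\<Sum>i = k + 1..length vs. int (min k (map f vs ! (i - 1))))"
    using k by (intro sum.reindex_bij_witness[of _ "\<lambda>i. i - k - 1" "\<lambda>i. i + k + 1"]) (auto simp: add.commute)
  finally have 1: "(\<Sum>v\<in>set vs - set (take k vs). int (min k (f v)))
      = (\<Sum>i = k + 1..length vs. int (min k (map f vs ! (i - 1))))" .
  have "(\<Sum>v\<in>set (take k vs). int (f v)) = (\<Sum>i = 0..<k. int (f (vs ! i)))"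
    using vs k by (simp add: sum.distinct_set_conv_list sum_list_sum_nth)
  also have "\<dots> = (\<Sum>i = 1..k. int (map f vs ! (i - 1)))"
    using k by (intro sum.reindex_bij_witness[of _ "\<lambda>i. i - 1" "\<lambda>i. i + 1"]) auto
  finally show ?thesis unfolding EG_diff_def slack_def card using 1 by simp
qed

text \<open>
  List the vertices by nonincreasing degree. The first \<open>k\<close> of them minimise the slack among all
  sets of \<open>k\<close> vertices by the exchange argument, so a set of slack at most 1 exists exactly if the
  Erdos-Gallai difference is at most 1. The indices up to \<open>m_index\<close> are those with
  \<open>d ! (k - 1) \<ge> k - 1\<close>, since this condition is inherited by smaller indices.
\<close>

lemma weakly_threshold_sequence_iff_small_slack:
  assumes fin: "finite V" and ne: "V \<noteq> {}"
  shows "weakly_threshold_sequence (degree_sequence V E) \<longleftrightarrow> small_slack V (degree V E)"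
proof -
  define f where "f = degree V E"
  obtain vs where vs: "distinct vs" "set vs = V" "sorted_wrt (\<lambda>u v. f v \<le> f u) vs"
    and ds: "map f vs = degree_sequence V E"
    using degree_sequence_enumeration[OF fin, of f] unfolding degree_sequence_def f_def by metis
  define n where "n = length vs"
  have n: "n = card V" "n \<ge> 1"
    using vs ne by (auto simp: n_def distinct_card[symmetric] Suc_le_eq)
  have anti: "f (vs ! j) \<le> f (vs ! i)" if "i \<le> j" "j < n" for i j
    using vs(3) that sorted_wrt_nth_less[of _ vs i j] by (cases "i = j") (auto simp: n_def)
  \<comment> \<open>The set whose maximum is \<open>m_index\<close>; it is an initial segment, so \<open>S = {1..m_index}\<close>.\<close>
  define S where "S = {i. 1 \<le> i \<and> i \<le> n \<and> f (vs ! (i - 1)) \<ge> i - 1}"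
  have S: "finite S" "1 \<in> S" using n by (auto simp: S_def)
  have down: "i \<in> S" if "j \<in> S" "1 \<le> i" "i \<le> j" for i j
  proof -
    have "i - 1 \<le> j - 1" "j - 1 \<le> f (vs ! (j - 1))" "j \<le> n" using that by (auto simp: S_def)
    then have "i - 1 \<le> f (vs ! (i - 1))" using anti[of "i - 1" "j - 1"] that by linarith
    then show ?thesis using that \<open>j \<le> n\<close> by (simp add: S_def)
  qed
  have "m_index (map f vs) = Max S"
    unfolding m_index_def S_def n_def by (rule arg_cong[where f = Max]) auto
  then have m: "k \<in> {1..m_index (map f vs)} \<longleftrightarrow> k \<in> S" for k
  proof -
    have "Max S \<in> S" using S by (intro Max_in) auto
    moreover have "1 \<le> k" if "k \<in> S" using that by (simp add: S_def)
    ultimately show ?thesis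
      using S(1) down[of "Max S" k] Max_ge[of S k] \<open>m_index (map f vs) = Max S\<close> by auto
  qed
  have S_iff: "k \<in> S \<longleftrightarrow> k \<le> card {v \<in> V. k \<le> Suc (f v)}" if "1 \<le> k" for k
  proof
    assume k: "k \<in> S"
    have "set (take k vs) \<subseteq> {v \<in> V. k \<le> Suc (f v)}"
    proof
      fix v assume v: "v \<in> set (take k vs)"
      then obtain i where i: "i < k" "i < n" "v = vs ! i" by (auto simp: in_set_conv_nth n_def)
      have "f (vs ! (k - 1)) \<le> f v" using anti[of i "k - 1"] i k by (auto simp: S_def)
      then show "v \<in> {v \<in> V. k \<le> Suc (f v)}"
        using v k set_take_subset[of k vs] vs(2) by (auto simp: S_def)
    qed
    then have "card (set (take k vs)) \<le> card {v \<in> V. k \<le> Suc (f v)}"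
      using fin by (intro card_mono) auto
    then show "k \<le> card {v \<in> V. k \<le> Suc (f v)}"
      using vs k by (simp add: distinct_card S_def n_def)
  next
    assume k: "k \<le> card {v \<in> V. k \<le> Suc (f v)}"
    have kn: "k \<le> n" using count_le_card[OF fin k] n by simp
    show "k \<in> S"
    proof (rule ccontr)
      assume "k \<notin> S"
      then have lt: "f (vs ! (k - 1)) < k - 1" using kn that by (auto simp: S_def)
      have "{v \<in> V. k \<le> Suc (f v)} \<subseteq> set (take (k - 1) vs)"
      proof
        fix v assume v: "v \<in> {v \<in> V. k \<le> Suc (f v)}"
        then obtain i where i: "i < n" "v = vs ! i" using vs(2) by (auto simp: in_set_conv_nth n_def)
        have "i < k - 1" using anti[of "k - 1" i] i v lt by (cases "i < k - 1") auto
        then show "v \<in> set (take (k - 1) vs)" using i by (auto simp: in_set_conv_nth n_def)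
      qed
      then have "card {v \<in> V. k \<le> Suc (f v)} \<le> card (set (take (k - 1) vs))"
        by (intro card_mono) auto
      also have "\<dots> \<le> k - 1" using card_length[of "take (k - 1) vs"] by simp
      finally show False using k that by simp
    qed
  qed
  have slack_iff: "EG_diff (map f vs) k \<le> 1 \<longleftrightarrow> (\<exists>B\<subseteq>V. card B = k \<and> slack V f B \<le> 1)"
    if "k \<in> S" for k
  proof -
    let ?T = "set (take k vs)"
    have k: "k \<le> n" using that by (simp add: S_def)
    have T: "?T \<subseteq> V" "card ?T = k" using k vs set_take_subset[of k vs] by (auto simp: n_def distinct_card)
    have EG: "EG_diff (map f vs) k = slack V f ?T"
      using EG_diff_eq_slack[OF vs(1), of k f] k vs(2) by (simp add: n_def)
    have top: "f v \<le> f p" if pT: "p \<in> ?T" and vT: "v \<in> V - ?T" for p v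
    proof -
      obtain i where i: "i < k" "i < n" "p = vs ! i" using pT by (auto simp: in_set_conv_nth n_def)
      obtain j where j: "j < n" "v = vs ! j" using vT vs(2) by (auto simp: in_set_conv_nth n_def)
      have "\<not> j < k" using j vT by (auto simp: in_set_conv_nth n_def)
      then show ?thesis using anti[of i j] i j by simp
    qed
    have "slack V f ?T \<le> 1" if B: "B \<subseteq> V" "card B = k" "slack V f B \<le> 1" for B
    proof -
      obtain C where "?T \<subseteq> C" "C \<subseteq> ?T" "card C = card B" "slack V f C \<le> 1"
        by (rule slack_exchange_between[OF fin B(1,3), of ?T ?T]) (use T B(2) top in auto)
      then show ?thesis by (metis subset_antisym)
    qed
    then show ?thesis using EG T by auto
  qed
  have "weakly_threshold_sequence (map f vs) \<longleftrightarrow> (\<forall>k\<in>S. EG_diff (map f vs) k \<le> 1)"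
    unfolding weakly_threshold_sequence_def using m by blast
  also have "\<dots> \<longleftrightarrow> small_slack V f"
  proof
    assume L: "\<forall>k\<in>S. EG_diff (map f vs) k \<le> 1"
    show "small_slack V f"
    proof (rule small_slackI)
      fix k assume k: "k \<le> card {v \<in> V. k \<le> Suc (f v)}"
      show "\<exists>B\<subseteq>V. card B = k \<and> slack V f B \<le> 1"
      proof (cases "k = 0")
        case False
        then have "k \<in> S" using S_iff k by simp
        then show ?thesis using slack_iff L by blast
      qed (intro exI[of _ "{}"], auto)
    qed
  next
    assume ss: "small_slack V f"
    show "\<forall>k\<in>S. EG_diff (map f vs) k \<le> 1"
    proof
      fix k assume k: "k \<in> S"
      then have "1 \<le> k" by (simp add: S_def)
      then have "k \<le> card {v \<in> V. k \<le> Suc (f v)}" using S_iff k by simp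
      with ss have "\<exists>B\<subseteq>V. card B = k \<and> slack V f B \<le> 1" by (auto simp: small_slack_def)
      then show "EG_diff (map f vs) k \<le> 1" using slack_iff k by simp
    qed
  qed
  finally show ?thesis unfolding ds unfolding f_def .
qed

section \<open>Attaching and detaching vertices\<close>

lemma simple_graphD:
  assumes "simple_graph V E"
  shows "finite V" "V \<noteq> {}" "E \<subseteq> Pow V" "{v, v} \<notin> E"
    "e \<in> E \<Longrightarrow> \<exists>u v. e = {u, v} \<and> u \<in> V \<and> v \<in> V \<and> u \<noteq> v"
  using assms by (auto simp: simple_graph_def doubleton_eq_iff)

lemma degree_less_card:
  assumes "simple_graph V E" "v \<in> V"
  shows "degree V E v < card V"
proof -
  have "{u \<in> V. {u, v} \<in> E} \<subseteq> V - {v}" using simple_graphD(4)[OF assms(1)] by auto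
  then have "{u \<in> V. {u, v} \<in> E} \<subset> V" using assms(2) by auto
  then show ?thesis
    unfolding degree_def using simple_graphD(1)[OF assms(1)] by (rule psubset_card_mono[rotated])
qed

lemma degree_attach:
  assumes "finite V" "E \<subseteq> Pow V" "x \<notin> V" "N \<subseteq> V"
  shows "degree (insert x V) (E \<union> {{x, u} | u. u \<in> N}) x = card N"
    and "v \<in> V \<Longrightarrow> degree (insert x V) (E \<union> {{x, u} | u. u \<in> N}) v = degree V E v + of_bool (v \<in> N)"
proof -
  have "{u \<in> insert x V. {u, x} \<in> E \<union> {{x, u} | u. u \<in> N}} = N"
    using assms by (auto simp: doubleton_eq_iff)
  then show "degree (insert x V) (E \<union> {{x, u} | u. u \<in> N}) x = card N"
    by (simp add: degree_def)
  assume v: "v \<in> V"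
  have "{u \<in> insert x V. {u, v} \<in> E \<union> {{x, u} | u. u \<in> N}}
      = {u \<in> V. {u, v} \<in> E} \<union> (if v \<in> N then {x} else {})"
    using assms v by (auto simp: doubleton_eq_iff)
  then show "degree (insert x V) (E \<union> {{x, u} | u. u \<in> N}) v = degree V E v + of_bool (v \<in> N)"
    using assms by (simp add: degree_def)
qed

lemma simple_graph_attach:
  assumes "simple_graph V E" "x \<notin> V" "N \<subseteq> V"
  shows "simple_graph (insert x V) (E \<union> {{x, u} | u. u \<in> N})"
  using assms unfolding simple_graph_def by fastforce

text \<open>
  Inverse to attaching: every vertex of a graph with other vertices arises by attaching it to
  its neighbourhood \<open>N\<close> in the rest.
\<close>

lemma simple_graph_detach:
  assumes G: "simple_graph V E" and x: "x \<in> V" "V \<noteq> {x}"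
  obtains V' E' N where "V = insert x V'" "x \<notin> V'" "simple_graph V' E'" "N \<subseteq> V'"
    "E = E' \<union> {{x, u} | u. u \<in> N}" "card N = degree V E x" "\<And>v. v \<in> N \<longleftrightarrow> {v, x} \<in> E"
    "\<And>v. v \<in> V' \<Longrightarrow> degree V E v = degree V' E' v + of_bool (v \<in> N)"
proof -
  define V' E' N where "V' = V - {x}" and "E' = {e \<in> E. x \<notin> e}" and "N = {v. {v, x} \<in> E}"
  have V: "V = insert x V'" "x \<notin> V'" using x by (auto simp: V'_def)
  have G': "simple_graph V' E'" using G x unfolding simple_graph_def V'_def E'_def by fastforce
  have N: "N \<subseteq> V'" using simple_graphD(3,4)[OF G] by (auto simp: N_def V'_def)
  have E: "E = E' \<union> {{x, u} | u. u \<in> N}"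
  proof
    show "E \<subseteq> E' \<union> {{x, u} | u. u \<in> N}"
    proof
      fix e assume e: "e \<in> E"
      then obtain u v where uv: "e = {u, v}" using simple_graphD(5)[OF G] by blast
      then show "e \<in> E' \<union> {{x, u} | u. u \<in> N}"
        using e by (cases "x = u"; cases "x = v") (auto simp: E'_def N_def insert_commute)
    qed
  qed (auto simp: E'_def N_def insert_commute)
  note d = degree_attach[OF simple_graphD(1,3)[OF G'] V(2) N]
  show ?thesis
    using that[OF V G' N E] d unfolding V(1)[symmetric] E[symmetric] by (auto simp: N_def)
qed

lemma semi_joined_P4_degrees:
  assumes fin: "finite V" and EV: "E \<subseteq> Pow V" and dist: "distinct [a, b, c, e]" "{a, b, c, e} \<inter> V = {}"
  defines "V' \<equiv> V \<union> {a, b, c, e}"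
    and "E' \<equiv> E \<union> {{a, b}, {b, c}, {c, e}} \<union> {{x, u} | x u. x \<in> {b, c} \<and> u \<in> V}"
  shows "degree V' E' a = 1" "degree V' E' e = 1"
    "degree V' E' b = card V + 2" "degree V' E' c = card V + 2"
    "v \<in> V \<Longrightarrow> degree V' E' v = degree V E v + 2"
proof -
  have nin: "{u, v} \<notin> E" if "v \<in> {a, b, c, e}" for u v using that EV dist by auto
  have "{u \<in> V'. {u, a} \<in> E'} = {b}" "{u \<in> V'. {u, e} \<in> E'} = {c}"
    "{u \<in> V'. {u, b} \<in> E'} = V \<union> {a, c}" "{u \<in> V'. {u, c} \<in> E'} = V \<union> {b, e}"
    using dist nin by (auto simp: V'_def E'_def doubleton_eq_iff)
  then show "degree V' E' a = 1" "degree V' E' e = 1"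
    "degree V' E' b = card V + 2" "degree V' E' c = card V + 2"
    using fin dist by (simp_all add: degree_def)
  assume v: "v \<in> V"
  have nin': "{u, v} \<notin> E" if "u \<in> {a, b, c, e}" for u using that EV dist by auto
  have "{u \<in> V'. {u, v} \<in> E'} = {u \<in> V. {u, v} \<in> E} \<union> {b, c}"
    using dist nin' v by (auto simp: V'_def E'_def doubleton_eq_iff)
  moreover have "{u \<in> V. {u, v} \<in> E} \<inter> {b, c} = {}" using dist by auto
  ultimately show "degree V' E' v = degree V E v + 2"
    using fin dist by (simp add: degree_def card_Un_disjoint)
qed

text \<open>
  The graph \<open>(V, E)\<close> may be empty; then the new graph is \<open>P\<^sub>4\<close> itself, which settles that base case.
\<close>

lemma semi_joined_P4_small_slack_iff:
  assumes "finite V" "E \<subseteq> Pow V" "distinct [a, b, c, e]" "{a, b, c, e} \<inter> V = {}"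
    and bound: "\<And>v. v \<in> V \<Longrightarrow> degree V E v < card V"
  defines "V' \<equiv> V \<union> {a, b, c, e}"
    and "E' \<equiv> E \<union> {{a, b}, {b, c}, {c, e}} \<union> {{x, u} | x u. x \<in> {b, c} \<and> u \<in> V}"
  shows "small_slack V' (degree V' E') \<longleftrightarrow> small_slack V (degree V E)"
  unfolding V'_def E'_def
  by (rule small_slack_semi_joined_P4_iff[OF assms(1,3,4) bound semi_joined_P4_degrees[OF assms(1-4)]])

section \<open>Buildable graphs have small slack\<close>

lemma buildable_imp_small_slack:
  assumes "buildable V E"
  shows "simple_graph V E \<and> small_slack V (degree V E)"
  using assms
proof induction
  case (K1 V E)
  then have "card V = 1"
    using bij_betw_same_card[of _ V K1_verts] by (auto simp: graph_iso_def K1_verts_def)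
  then obtain x where V: "V = {x}" by (meson card_1_singletonE)
  have "degree V E x = 0" using degree_less_card[OF K1(1), of x] V by simp
  then have "small_slack (insert x {}) (degree V E)"
    using small_slack_dominating_iff[of "{}" x "degree V E" "degree V E"] small_slack_empty by auto
  then show ?case using V K1(1) by simp
next
  case (P4 V E)
  then obtain f where f: "bij_betw f V P4_verts"
    "\<And>u v. u \<in> V \<Longrightarrow> v \<in> V \<Longrightarrow> {u, v} \<in> E \<longleftrightarrow> {f u, f v} \<in> P4_edges"
    by (auto simp: graph_iso_def)
  define g where "g = inv_into V f"
  have g: "bij_betw g P4_verts V" unfolding g_def by (rule bij_betw_inv_into[OF f(1)])
  have fg: "f (g i) = i" if "i \<in> P4_verts" for i
    using that bij_betw_inv_into_right[OF f(1)] by (simp add: g_def)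
  have V: "V = {g 0, g 1, g 2, g 3}" using bij_betw_imp_surj_on[OF g] by (auto simp: P4_verts_def)
  have edge: "{g i, g j} \<in> E \<longleftrightarrow> {i, j} \<in> P4_edges" if "i \<in> P4_verts" "j \<in> P4_verts" for i j
    using f(2)[of "g i" "g j"] fg that bij_betw_apply[OF g] by simp
  have dist: "distinct [g 0, g 1, g 2, g 3]"
    using bij_betw_imp_inj_on[OF g] by (auto simp: P4_verts_def inj_on_def)
  have "E = {{g 0, g 1}, {g 1, g 2}, {g 2, g 3}}"
  proof
    show "E \<subseteq> {{g 0, g 1}, {g 1, g 2}, {g 2, g 3}}"
    proof
      fix e assume e: "e \<in> E"
      then obtain u v where uv: "e = {u, v}" "u \<in> V" "v \<in> V"
        using simple_graphD(5)[OF P4(1)] by blast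
      have "V = g ` P4_verts" using bij_betw_imp_surj_on[OF g] by simp
      then obtain i j where ij: "i \<in> P4_verts" "j \<in> P4_verts" "u = g i" "v = g j"
        using uv by auto
      then have "{i, j} \<in> P4_edges" using edge e uv by simp
      then show "e \<in> {{g 0, g 1}, {g 1, g 2}, {g 2, g 3}}"
        unfolding uv ij P4_edges_def by (auto simp: doubleton_eq_iff insert_commute)
    qed
    show "{{g 0, g 1}, {g 1, g 2}, {g 2, g 3}} \<subseteq> E"
      using edge[of 0 1] edge[of 1 2] edge[of 2 3] by (simp add: P4_verts_def P4_edges_def)
  qed
  then have "small_slack V (degree V E)"
    using semi_joined_P4_small_slack_iff[of "{}" "{}" "g 0" "g 1" "g 2" "g 3"] dist V small_slack_empty
    by simp
  then show ?case using P4(1) by blast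
next
  case (dominating V E x)
  then have G: "simple_graph V E" and ss: "small_slack V (degree V E)" by auto
  note d = degree_attach[OF simple_graphD(1,3)[OF G] dominating(2) subset_refl]
  have "small_slack (insert x V) (degree (insert x V) (E \<union> {{x, u} | u. u \<in> V}))"
    using small_slack_dominating_iff[OF simple_graphD(1)[OF G] dominating(2),
        of "degree V E" "degree (insert x V) (E \<union> {{x, u} | u. u \<in> V})"]
      degree_less_card[OF G] d ss by simp
  then show ?case using simple_graph_attach[OF G dominating(2)] by blast
next
  case (isolated V E x)
  then have G: "simple_graph V E" and ss: "small_slack V (degree V E)" by auto
  note d = degree_attach[OF simple_graphD(1,3)[OF G] isolated(2) empty_subsetI]
  have "small_slack (insert x V) (degree (insert x V) E)"
    using small_slack_isolated_iff[OF simple_graphD(1)[OF G] isolated(2) simple_graphD(2)[OF G],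
        of "degree (insert x V) E" "degree V E"] d ss by simp
  then show ?case using simple_graph_attach[OF G isolated(2), of "{}"] by simp
next
  case (weakly_dominating V E x w)
  then have G: "simple_graph V E" and ss: "small_slack V (degree V E)" by auto
  have w: "w \<in> V" "\<And>v. v \<in> V \<Longrightarrow> degree V E w \<le> degree V E v"
    using weakly_dominating(3) by (auto simp: min_degree_vertex_def)
  note fin = simple_graphD(1)[OF G]
  note d = degree_attach[OF fin simple_graphD(3)[OF G] weakly_dominating(2) Diff_subset[of V "{w}"]]
  have "small_slack (insert x V) (degree (insert x V) (E \<union> {{x, u} | u. u \<in> V - {w}}))"
    by (rule small_slack_add_weakly_dominating[OF fin weakly_dominating(2) w(1) degree_less_card[OF G] w(2) _ _ _ ss])
      (use d w(1) fin in simp_all)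
  then show ?case using simple_graph_attach[OF G weakly_dominating(2), of "V - {w}"] by blast
next
  case (weakly_isolated V E x w)
  then have G: "simple_graph V E" and ss: "small_slack V (degree V E)" by auto
  have w: "w \<in> V" "\<And>v. v \<in> V \<Longrightarrow> degree V E v \<le> degree V E w"
    using weakly_isolated(3) by (auto simp: max_degree_vertex_def)
  note fin = simple_graphD(1)[OF G]
  have N: "{w} \<subseteq> V" using w by simp
  note d = degree_attach[OF fin simple_graphD(3)[OF G] weakly_isolated(2) N]
  have "small_slack (insert x V) (degree (insert x V) (E \<union> {{x, u} | u. u \<in> {w}}))"
    by (rule small_slack_add_weakly_isolated[OF fin weakly_isolated(2) w _ _ _ ss])
      (use d w(1) in simp_all)
  then show ?case using simple_graph_attach[OF G weakly_isolated(2) N] by simp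
next
  case (semi_joined_P4 V E a b c e)
  then have G: "simple_graph V E" and ss: "small_slack V (degree V E)" by auto
  let ?V = "V \<union> {a, b, c, e}"
  let ?E = "E \<union> {{a, b}, {b, c}, {c, e}} \<union> {{x, u} | x u. x \<in> {b, c} \<and> u \<in> V}"
  have "small_slack ?V (degree ?V ?E)"
    using semi_joined_P4_small_slack_iff[OF simple_graphD(1,3)[OF G] semi_joined_P4(2,3) degree_less_card[OF G]]
      ss by simp
  moreover have "simple_graph ?V ?E"
    unfolding simple_graph_def
  proof (intro conjI subsetI)
    show "finite ?V" "?V \<noteq> {}" using simple_graphD(1)[OF G] by auto
    fix f assume "f \<in> ?E"
    then consider "f \<in> E" | "f = {a, b}" | "f = {b, c}" | "f = {c, e}"
      | x u where "f = {x, u}" "x \<in> {b, c}" "u \<in> V" by blast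
    then show "f \<in> {{u, v} | u v. u \<in> ?V \<and> v \<in> ?V \<and> u \<noteq> v}"
    proof cases
      case 1
      then obtain u v where "f = {u, v}" "u \<in> V" "v \<in> V" "u \<noteq> v"
        using simple_graphD(5)[OF G] by blast
      then show ?thesis by blast
    next
      case (5 x u)
      then have "x \<noteq> u" "x \<in> ?V" "u \<in> ?V" using semi_joined_P4(3) by auto
      then show ?thesis using 5 by blast
    qed (use semi_joined_P4(2) in auto)
  qed
  ultimately show ?case by simp
qed

section \<open>Graphs of small slack are buildable\<close>

text \<open>
  With no isolated vertices, the slack of \<open>{s}\<close> is the number \<open>card V - 1 - d s\<close> of
  non-neighbours of \<open>s\<close>.
\<close>

lemma small_slack_imp_almost_dominating:
  assumes fin: "finite V" and ne: "V \<noteq> {}" and pos: "\<And>v. v \<in> V \<Longrightarrow> 1 \<le> d v"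
    and ss: "small_slack V d"
  obtains s where "s \<in> V" "card V \<le> d s + 2"
proof -
  have n: "1 \<le> card V" using fin ne by (metis One_nat_def Suc_leI card_gt_0_iff)
  then have "1 \<le> card {v \<in> V. 1 \<le> Suc (d v)}" by simp
  then obtain B where B: "B \<subseteq> V" "card B = 1" "slack V d B \<le> 1" using small_slackD[OF ss] by blast
  then obtain s where Bs: "B = {s}" by (meson card_1_singletonE)
  have sV: "s \<in> V" using B Bs by auto
  have "(\<Sum>v\<in>V - {s}. int (min 1 (d v))) = (\<Sum>v\<in>V - {s}. 1)"
    using pos by (intro sum.cong) (auto simp: min_def)
  then have "int (card V) - 1 - int (d s) \<le> 1"
    using B(3) sV fin n by (simp add: slack_def Bs of_nat_diff)
  then have "card V \<le> d s + 2" by linarith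
  with sV show ?thesis by (rule that)
qed

text \<open>
  If all degrees were at least 2, the slack of a pair would be the number of
  non-neighbours of its two members, counted separately, which is at least 2 when neither vertex is dominating.
\<close>

lemma small_slack_imp_leaf:
  assumes fin: "finite V" and n: "2 \<le> card V" and pos: "\<And>v. v \<in> V \<Longrightarrow> 1 \<le> d v"
    and bound: "\<And>v. v \<in> V \<Longrightarrow> d v + 2 \<le> card V" and ss: "small_slack V d"
  obtains t where "t \<in> V" "d t = 1"
proof -
  have "\<exists>t\<in>V. d t = 1"
  proof (rule ccontr)
    assume "\<not> (\<exists>t\<in>V. d t = 1)"
    then have two: "2 \<le> d v" if "v \<in> V" for v using pos[OF that] that by force
    have "{v \<in> V. 2 \<le> Suc (d v)} = V" using pos by force
    then obtain B where B: "B \<subseteq> V" "card B = 2" "slack V d B \<le> 1"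
      using small_slackD[OF ss, of 2] n by auto
    obtain p q where pq: "B = {p, q}" "p \<noteq> q" using B(2) by (meson card_2_iff)
    have pqV: "p \<in> V" "q \<in> V" using B(1) pq by auto
    have "(\<Sum>v\<in>V - B. int (min 2 (d v))) = (\<Sum>v\<in>V - B. 2)"
      using two by (intro sum.cong) (auto simp: min_def)
    also have "\<dots> = 2 * (int (card V) - 2)"
      using B fin n finite_subset[OF B(1) fin] by (simp add: card_Diff_subset of_nat_diff)
    finally have "2 + 2 * (int (card V) - 2) - (int (d p) + int (d q)) \<le> 1"
      using B(3) pq unfolding slack_def B(2) by simp
    moreover have "int (d p) + 2 \<le> int (card V)" "int (d q) + 2 \<le> int (card V)"
      using bound[OF pqV(1)] bound[OF pqV(2)] by linarith+
    ultimately show False by presburger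
  qed
  then show ?thesis using that by blast
qed

lemma leaf_neighbour_unique:
  assumes G: "simple_graph V E" and v: "degree V E v = 1" and u: "{u, v} \<in> E" "{u', v} \<in> E"
  shows "u = u'"
proof -
  have "u \<in> {u \<in> V. {u, v} \<in> E}" "u' \<in> {u \<in> V. {u, v} \<in> E}" using u simple_graphD(3)[OF G] by auto
  moreover obtain y where "{u \<in> V. {u, v} \<in> E} = {y}"
    using v unfolding degree_def by (meson card_1_singletonE)
  ultimately show ?thesis by auto
qed

lemma almost_dominating_neighbours:
  assumes G: "simple_graph V E" and sV: "s \<in> V" and ds: "degree V E s + 2 = card V"
    and y: "y \<in> V" "y \<noteq> s" "{y, s} \<notin> E" and x: "x \<in> V"
  shows "{x, s} \<in> E \<longleftrightarrow> x \<notin> {s, y}"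
proof -
  have "{u \<in> V. {u, s} \<in> E} = V - {s, y}"
  proof (rule card_subset_eq)
    show "{u \<in> V. {u, s} \<in> E} \<subseteq> V - {s, y}" using y simple_graphD(4)[OF G] by auto
    show "card {u \<in> V. {u, s} \<in> E} = card (V - {s, y})"
      using ds y sV simple_graphD(1)[OF G] unfolding degree_def by (simp add: card_Diff_subset)
  qed (use simple_graphD(1)[OF G] in auto)
  then show ?thesis using x by blast
qed

text \<open>
  The bounds leave only three vertices of degree 1 below that size: two of them are adjacent, and
  the neighbour of the third would have two neighbours. The bound keeps vertices of degree 1 apart from those
  of degree \<open>card V - 2\<close>.
\<close>

lemma no_isolated_no_dominating_card_ge_4:
  assumes G: "simple_graph V E"
    and inner: "\<And>v. v \<in> V \<Longrightarrow> 1 \<le> degree V E v" "\<And>v. v \<in> V \<Longrightarrow> degree V E v + 2 \<le> card V"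
  shows "4 \<le> card V"
proof (rule ccontr)
  note EV = simple_graphD(3)[OF G] and noloop = simple_graphD(4)[OF G] and fin = simple_graphD(1)[OF G]
  assume "\<not> 4 \<le> card V"
  moreover obtain s where sV: "s \<in> V" using simple_graphD(2)[OF G] by auto
  ultimately have n: "card V = 3" using inner(1)[OF sV] inner(2)[OF sV] by linarith
  then have one: "degree V E v = 1" if "v \<in> V" for v
    using inner(1)[OF that] inner(2)[OF that] by linarith
  obtain y where ys: "{y, s} \<in> E"
    using one[OF sV] unfolding degree_def by (metis (no_types, lifting) card_1_singletonE insertI1 mem_Collect_eq)
  then have yV: "y \<in> V" "y \<noteq> s" using EV noloop by auto
  have "card (V - {s, y}) = 1" using n yV sV fin by simp
  then obtain z where z: "V - {s, y} = {z}" by (meson card_1_singletonE)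
  then have zV: "z \<in> V" "z \<noteq> s" "z \<noteq> y" by auto
  obtain u where uz: "{u, z} \<in> E"
    using one[OF zV(1)] unfolding degree_def by (metis (no_types, lifting) card_1_singletonE insertI1 mem_Collect_eq)
  then have "u \<in> V" "u \<noteq> z" using EV noloop by auto
  then have "u = s \<or> u = y" using z by auto
  then show False
    using leaf_neighbour_unique[OF G one[OF sV] ys, of z] leaf_neighbour_unique[OF G one[OF yV(1)], of s z] uz ys zV
    by (auto simp: insert_commute)
qed

text \<open>
  The situation of the induction step in which neither an isolated nor a dominating vertex can be
  deleted.
\<close>

locale no_extreme_vertex_step =
  fixes V :: "'a set" and E :: "'a set set"
  assumes G: "simple_graph V E"
    and ss: "small_slack V (degree V E)"
    and smaller: "\<And>V' E'. simple_graph V' E' \<Longrightarrow> small_slack V' (degree V' E') \<Longrightarrow> V' \<subset> V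
      \<Longrightarrow> buildable V' E'"
    and no_isolated: "\<And>v. v \<in> V \<Longrightarrow> 1 \<le> degree V E v"
    and no_dominating: "\<And>v. v \<in> V \<Longrightarrow> degree V E v + 2 \<le> card V"
begin

lemmas fin = simple_graphD(1)[OF G]
lemmas edges_in_V = simple_graphD(3)[OF G]
lemmas card_ge_4 = no_isolated_no_dominating_card_ge_4[OF G no_isolated no_dominating]

lemma not_singleton: "V \<noteq> {x}"
  using card_ge_4 by auto

text \<open>
  Here \<open>t\<close> is the only non-neighbour of \<open>s\<close>. No leaf hangs on \<open>s\<close>, so deleting \<open>s\<close> creates no isolated
  vertex, and \<open>t\<close>, still of degree 1, has minimum degree in the rest.
\<close>

lemma buildable_by_weakly_dominating:
  assumes sV: "s \<in> V" and ds: "degree V E s + 2 = card V" and tV: "t \<in> V" and dt: "degree V E t = 1"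
    and st: "{t, s} \<notin> E" and nl: "\<And>v. v \<in> V \<Longrightarrow> degree V E v = 1 \<Longrightarrow> {v, s} \<notin> E"
  shows "buildable V E"
proof -
  obtain V' E' N where V': "V = insert s V'" "s \<notin> V'" and G': "simple_graph V' E'"
    and N: "N \<subseteq> V'" "E = E' \<union> {{s, u} | u. u \<in> N}" "card N = degree V E s"
      "\<And>v. v \<in> N \<longleftrightarrow> {v, s} \<in> E"
    and d: "\<And>v. v \<in> V' \<Longrightarrow> degree V E v = degree V' E' v + of_bool (v \<in> N)"
    by (rule simple_graph_detach[OF G sV not_singleton]) blast
  note fin' = simple_graphD(1)[OF G']
  have n: "card V = Suc (card V')" using V' fin' by simp
  have "t \<noteq> s" using ds dt card_ge_4 by auto
  then have tV': "t \<in> V'" "t \<notin> N" using tV V' st N(4) by auto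
  have NV: "N = V' - {t}"
    using N(1,3) ds n fin' tV' by (intro card_subset_eq) auto
  have dt': "degree V' E' t = 1" using d[OF tV'(1)] tV'(2) dt by simp
  have min: "degree V' E' t \<le> degree V' E' v" if v: "v \<in> V'" for v
  proof (rule ccontr)
    assume "\<not> degree V' E' t \<le> degree V' E' v"
    then have "degree V' E' v = 0" using dt' by simp
    moreover have "1 \<le> degree V E v" using no_isolated v V' by simp
    ultimately have "v \<in> N" "degree V E v = 1" using d[OF v] by (cases "v \<in> N"; simp)+
    then show False using nl[of v] v V' N(4) by auto
  qed
  have "small_slack V' (degree V' E')"
  proof (rule small_slack_delete_weakly_dominating[where d = "degree V' E'" and d' = "degree V E",
        OF fin' V'(2) tV'(1) degree_less_card[OF G'] min])
    show "degree V E s = card V' - 1" using ds n by simp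
    show "degree V E t = degree V' E' t" using dt dt' by simp
    show "degree V E v = Suc (degree V' E' v)" if "v \<in> V' - {t}" for v using d[of v] that NV by simp
    show "degree V E v \<le> degree V E s" if "v \<in> V'" for v using no_dominating[of v] that V' ds by auto
    show "small_slack (insert s V') (degree V E)" using ss V'(1) by simp
  qed
  then have "buildable V' E'" using smaller[OF G'] V' by auto
  moreover have "min_degree_vertex V' E' t" using min tV' by (simp add: min_degree_vertex_def)
  ultimately show ?thesis
    using buildable.weakly_dominating[of V' E' s t] V' N(2) NV by simp
qed

text \<open>
  The leaf \<open>t\<close> hangs on \<open>s\<close>. Deleting \<open>t\<close> takes one from the degree of \<open>s\<close> only, and this degree stays maximal
  because, by assumption, every vertex of degree \<open>card V - 2\<close> is a neighbour of \<open>t\<close>, hence equal to \<open>s\<close>.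
\<close>

lemma buildable_by_weakly_isolated:
  assumes sV: "s \<in> V" and ds: "degree V E s + 2 = card V" and tV: "t \<in> V" and dt: "degree V E t = 1"
    and st: "{s, t} \<in> E" and nl: "\<And>v. v \<in> V \<Longrightarrow> degree V E v + 2 = card V \<Longrightarrow> {v, t} \<in> E"
  shows "buildable V E"
proof -
  obtain V' E' N where V': "V = insert t V'" "t \<notin> V'" and G': "simple_graph V' E'"
    and N: "N \<subseteq> V'" "E = E' \<union> {{t, u} | u. u \<in> N}" "card N = degree V E t"
      "\<And>v. v \<in> N \<longleftrightarrow> {v, t} \<in> E"
    and d: "\<And>v. v \<in> V' \<Longrightarrow> degree V E v = degree V' E' v + of_bool (v \<in> N)"
    by (rule simple_graph_detach[OF G tV not_singleton]) blast
  note fin' = simple_graphD(1)[OF G']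
  have sN: "s \<in> N" using N(4) st by simp
  then have NV: "N = {s}" using N(3) dt by (metis card_1_singletonE singletonD)
  have sV': "s \<in> V'" using sN N(1) by auto
  have max: "degree V' E' v \<le> degree V' E' s" if v: "v \<in> V'" for v
  proof (cases "v = s")
    case False
    then have "{v, t} \<notin> E" using N(4) NV by auto
    then have "degree V E v + 2 \<noteq> card V" using nl[of v] v V' by auto
    moreover have "degree V E v + 2 \<le> card V" using no_dominating v V' by simp
    ultimately show ?thesis using d[OF v] d[OF sV'] ds sN by simp
  qed simp
  have "small_slack V' (degree V' E')"
  proof (rule small_slack_delete_weakly_isolated[where d = "degree V' E'" and d' = "degree V E",
        OF fin' V'(2) sV' max])
    show "degree V E t = 1" using dt .
    show "degree V E s = Suc (degree V' E' s)" using d[OF sV'] sN by simp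
    show "degree V E v = degree V' E' v" if "v \<in> V' - {s}" for v using d[of v] that NV by simp
    show "1 \<le> degree V E v" if "v \<in> V'" for v using no_isolated that V' by simp
    show "small_slack (insert t V') (degree V E)" using ss V'(1) by simp
  qed
  then have "buildable V' E'" using smaller[OF G'] V' by auto
  moreover have "max_degree_vertex V' E' s" using max sV' by (simp add: max_degree_vertex_def)
  moreover have "E = E' \<union> {{t, s}}" using N(2) NV by auto
  ultimately show ?thesis
    using buildable.weakly_isolated[of V' E' t s] V' by simp
qed

text \<open>
  A leaf hangs on each of \<open>b\<close> and \<open>c\<close>, and each of these two misses exactly the leaf of the
  other one. So \<open>a, b, c, e\<close> is a path whose midpoints see every other vertex and whose ends see none.
\<close>

lemma buildable_by_semi_joined_P4:
  assumes b: "b \<in> V" "degree V E b + 2 = card V" and c: "c \<in> V" "degree V E c + 2 = card V" "c \<noteq> b"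
    and a: "a \<in> V" "degree V E a = 1" "{a, b} \<in> E" "{a, c} \<notin> E"
    and e: "e \<in> V" "degree V E e = 1" "{e, c} \<in> E" "{e, b} \<notin> E"
  shows "buildable V E"
proof -
  have ac: "a \<noteq> b" "a \<noteq> c" "e \<noteq> b" "e \<noteq> c" "a \<noteq> e" using a b c e card_ge_4 by auto
  then have dist: "distinct [a, b, c, e]" using c by auto
  define V' E' where "V' = V - {a, b, c, e}" and "E' = {f \<in> E. f \<subseteq> V'}"
  have V: "V = V' \<union> {a, b, c, e}" and disj: "{a, b, c, e} \<inter> V' = {}"
    using a b c e by (auto simp: V'_def)
  have nb: "{x, b} \<in> E \<longleftrightarrow> x \<notin> {b, e}" if "x \<in> V" for x
    by (rule almost_dominating_neighbours[OF G b e(1) ac(3) e(4) that])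
  have nc: "{x, c} \<in> E \<longleftrightarrow> x \<notin> {c, a}" if "x \<in> V" for x
    by (rule almost_dominating_neighbours[OF G c(1,2) a(1) ac(2) a(4) that])
  have na: "{x, a} \<in> E \<longleftrightarrow> x = b" for x
    using leaf_neighbour_unique[OF G a(2), of x b] a(3) by (auto simp: insert_commute)
  have ne: "{x, e} \<in> E \<longleftrightarrow> x = c" for x
    using leaf_neighbour_unique[OF G e(2), of x c] e(3) by (auto simp: insert_commute)
  have E: "E = E' \<union> {{a, b}, {b, c}, {c, e}} \<union> {{x, u} | x u. x \<in> {b, c} \<and> u \<in> V'}" (is "_ = ?E")
  proof
    have mem: "{u, v} \<in> ?E" if uv: "{u, v} \<in> E" and v: "v \<in> {a, b, c, e}" for u v
    proof -
      have "u \<in> V" using uv edges_in_V by auto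
      then have u: "u \<in> V' \<or> u \<in> {a, b, c, e}" using V by auto
      from v consider "v = a" | "v = b" | "v = c" | "v = e" by auto
      then show ?thesis
      proof cases
        case 1
        then have "u = b" using uv na by simp
        then have "{u, v} = {a, b}" using 1 by (simp add: insert_commute)
        then show ?thesis by simp
      next
        case 2
        then have "u \<in> V' \<or> u = a \<or> u = c" using uv nb[OF \<open>u \<in> V\<close>] u by auto
        then consider "u \<in> V'" "{u, v} = {b, u}" | "{u, v} = {a, b}" | "{u, v} = {b, c}"
          using 2 by (auto simp: insert_commute)
        then show ?thesis by cases blast+
      next
        case 3
        then have "u \<in> V' \<or> u = b \<or> u = e" using uv nc[OF \<open>u \<in> V\<close>] u by auto
        then consider "u \<in> V'" "{u, v} = {c, u}" | "{u, v} = {b, c}" | "{u, v} = {c, e}"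
          using 3 by (auto simp: insert_commute)
        then show ?thesis by cases blast+
      next
        case 4
        then have "u = c" using uv ne by simp
        then have "{u, v} = {c, e}" using 4 by simp
        then show ?thesis by simp
      qed
    qed
    show "E \<subseteq> ?E"
    proof
      fix f assume f: "f \<in> E"
      then obtain u v where uv: "f = {u, v}" "u \<in> V" "v \<in> V" using simple_graphD(5)[OF G] by blast
      show "f \<in> ?E"
      proof (cases "u \<in> V' \<and> v \<in> V'")
        case True then show ?thesis using f uv by (simp add: E'_def)
      next
        case False
        then have "u \<in> {a, b, c, e} \<or> v \<in> {a, b, c, e}" using uv V by blast
        then show ?thesis using mem[of u v] mem[of v u] f uv by (auto simp: insert_commute)
      qed
    qed
    have "{b, u} \<in> E" "{c, u} \<in> E" if "u \<in> V'" for u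
      using nb[of u] nc[of u] that V disj by (auto simp: insert_commute)
    moreover have "{b, c} \<in> E" using nc[OF b(1)] c(3) ac by auto
    moreover have "{c, e} \<in> E" using e(3) by (simp add: insert_commute)
    ultimately show "?E \<subseteq> E" using a(3) by (auto simp: E'_def)
  qed
  show ?thesis
  proof (cases "V' = {}")
    case True
    have E4: "E = {{a, b}, {b, c}, {c, e}}"
      using E True simple_graphD(5)[OF G] by (auto simp: E'_def)
    have V4: "V = {a, b, c, e}" using V True by simp
    define h :: "'a \<Rightarrow> nat" where "h = (\<lambda>x. if x = a then 0 else if x = b then 1 else if x = c then 2 else 3)"
    have h: "h a = 0" "h b = 1" "h c = 2" "h e = 3" using dist by (auto simp: h_def)
    have "bij_betw h V P4_verts"
      unfolding bij_betw_def V4 P4_verts_def using h by (auto simp: inj_on_def)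
    moreover have "\<forall>u\<in>V. \<forall>v\<in>V. {u, v} \<in> E \<longleftrightarrow> {h u, h v} \<in> P4_edges"
      unfolding V4 E4 P4_edges_def using h dist by (auto simp: doubleton_eq_iff)
    ultimately show ?thesis using buildable.P4[OF G] unfolding graph_iso_def by blast
  next
    case False
    have G': "simple_graph V' E'"
      unfolding simple_graph_def
    proof (intro conjI subsetI)
      show "finite V'" "V' \<noteq> {}" using fin False by (auto simp: V'_def)
      fix f assume f: "f \<in> E'"
      then have "f \<in> E" by (simp add: E'_def)
      then obtain u v where "f = {u, v}" "u \<noteq> v" using simple_graphD(5)[OF G] by blast
      then show "f \<in> {{u, v} | u v. u \<in> V' \<and> v \<in> V' \<and> u \<noteq> v}" using f by (auto simp: E'_def)
    qed
    have "small_slack V' (degree V' E')"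
      using semi_joined_P4_small_slack_iff[OF simple_graphD(1,3)[OF G'] dist disj degree_less_card[OF G']]
        ss unfolding E[symmetric] V[symmetric] by simp
    then have "buildable V' E'" using smaller[OF G'] a(1) by (auto simp: V'_def)
    then show ?thesis
      using buildable.semi_joined_P4[OF _ dist disj, of E'] unfolding E[symmetric] V[symmetric] by simp
  qed
qed

text \<open>
  If no leaf hangs on a vertex of degree \<open>card V - 2\<close>, then any such vertex can be deleted as weakly
  dominating. Otherwise let the leaf \<open>a\<close> hang on \<open>b\<close>. The leaf can be deleted as weakly isolated
  unless a second vertex \<open>c\<close> of degree \<open>card V - 2\<close> misses \<open>a\<close>; then \<open>c\<close> can be deleted as weakly
  dominating unless a leaf \<open>e\<close> hangs on it, and in this last case \<open>a, b, c, e\<close> is a semi-joined \<open>P\<^sub>4\<close>.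
\<close>

lemma buildable_without_extreme_vertices: "buildable V E"
proof -
  obtain s where sV: "s \<in> V" and "card V \<le> degree V E s + 2"
    using small_slack_imp_almost_dominating[OF fin simple_graphD(2)[OF G] no_isolated ss] by blast
  then have ds: "degree V E s + 2 = card V" using no_dominating[OF sV] by simp
  obtain t where tV: "t \<in> V" and dt: "degree V E t = 1"
    using small_slack_imp_leaf[OF fin _ no_isolated no_dominating ss] card_ge_4 by auto
  show ?thesis
  proof (cases "\<exists>b a. b \<in> V \<and> degree V E b + 2 = card V \<and> a \<in> V \<and> degree V E a = 1 \<and> {b, a} \<in> E")
    case False
    then show ?thesis
      by (intro buildable_by_weakly_dominating[OF sV ds tV dt])
        (use False sV ds tV dt in \<open>auto simp: insert_commute\<close>)
  next
    case True
    then obtain b a where b: "b \<in> V" "degree V E b + 2 = card V" and a: "a \<in> V" "degree V E a = 1" and ba: "{b, a} \<in> E"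
      by blast
    show ?thesis
    proof (cases "\<forall>v\<in>V. degree V E v + 2 = card V \<longrightarrow> {v, a} \<in> E")
      case True
      then show ?thesis using buildable_by_weakly_isolated[OF b a ba] by blast
    next
      case False
      then obtain c where c: "c \<in> V" "degree V E c + 2 = card V" and ca: "{c, a} \<notin> E" by blast
      have cb: "c \<noteq> b" using ba ca by auto
      have ac: "{a, c} \<notin> E" using ca by (simp add: insert_commute)
      show ?thesis
      proof (cases "\<exists>e\<in>V. degree V E e = 1 \<and> {e, c} \<in> E")
        case False
        then show ?thesis using buildable_by_weakly_dominating[OF c a ac] by blast
      next
        case True
        then obtain e where e: "e \<in> V" "degree V E e = 1" "{e, c} \<in> E" by blast
        have "{e, b} \<notin> E"
          using leaf_neighbour_unique[OF G e(2), of c b] e(3) cb by (auto simp: insert_commute)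
        then show ?thesis
          using buildable_by_semi_joined_P4[OF b c cb a _ ac e] ba by (simp add: insert_commute)
      qed
    qed
  qed
qed

end

lemma small_slack_imp_buildable:
  assumes "simple_graph V E" "small_slack V (degree V E)"
  shows "buildable V E"
  using assms
proof (induction "card V" arbitrary: V E rule: less_induct)
  case less
  note G = less.prems(1) and ss = less.prems(2)
  note fin = simple_graphD(1)[OF G] and EV = simple_graphD(3)[OF G]
  let ?d = "degree V E" and ?n = "card V"
  have IH: "buildable V' E'"
    if "simple_graph V' E'" "small_slack V' (degree V' E')" "V' \<subset> V" for V' E'
    using less.hyps[OF psubset_card_mono[OF fin that(3)] that(1,2)] .
  have d_eq_0: "{u, v} \<notin> E" if "?d v = 0" for u v
    using that fin EV by (auto simp: degree_def card_eq_0_iff)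
  show ?case
  proof (cases "?n = 1")
    case True
    then obtain x where V: "V = {x}" by (meson card_1_singletonE)
    then have "E = {}" using simple_graphD(5)[OF G] by fastforce
    then have "graph_iso V E K1_verts K1_edges"
      unfolding graph_iso_def V K1_verts_def K1_edges_def
      by (intro exI[of _ "\<lambda>_. 0"]) (simp add: bij_betw_def)
    then show ?thesis using buildable.K1 G by blast
  next
    case n1: False
    then have ns: "V \<noteq> {x}" for x by auto
    consider (iso) x where "x \<in> V" "?d x = 0" | (dom) x where "x \<in> V" "?d x = ?n - 1"
      | (inner) "\<And>v. v \<in> V \<Longrightarrow> 1 \<le> ?d v" "\<And>v. v \<in> V \<Longrightarrow> ?d v + 2 \<le> ?n"
    proof -
      have "?d v + 2 \<le> ?n" if "v \<in> V" "?d v \<noteq> ?n - 1" for v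
        using degree_less_card[OF G that(1)] that(2) by linarith
      then show ?thesis using that by (metis One_nat_def Suc_leI neq0_conv)
    qed
    then show ?thesis
    proof cases
      case iso
      obtain V' E' N where V': "V = insert x V'" "x \<notin> V'" and G': "simple_graph V' E'"
        and N: "N \<subseteq> V'" "E = E' \<union> {{x, u} | u. u \<in> N}" "card N = ?d x"
          "\<And>v. v \<in> N \<longleftrightarrow> {v, x} \<in> E"
        and d: "\<And>v. v \<in> V' \<Longrightarrow> ?d v = degree V' E' v + of_bool (v \<in> N)"
        by (rule simple_graph_detach[OF G iso(1) ns]) blast
      have "N = {}" using N(4) d_eq_0[OF iso(2)] by auto
      then have E: "E = E'" using N(2) by simp
      have "small_slack V' (degree V' E')"
        using small_slack_isolated_iff[OF simple_graphD(1)[OF G'] V'(2) simple_graphD(2)[OF G'], of ?d "degree V' E'"]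
          iso(2) d \<open>N = {}\<close> ss V'(1) by simp
      then have "buildable V' E'" using IH[OF G'] V' by auto
      then show ?thesis using buildable.isolated[of V' E' x] V' E by simp
    next
      case dom
      obtain V' E' N where V': "V = insert x V'" "x \<notin> V'" and G': "simple_graph V' E'"
        and N: "N \<subseteq> V'" "E = E' \<union> {{x, u} | u. u \<in> N}" "card N = ?d x"
          "\<And>v. v \<in> N \<longleftrightarrow> {v, x} \<in> E"
        and d: "\<And>v. v \<in> V' \<Longrightarrow> ?d v = degree V' E' v + of_bool (v \<in> N)"
        by (rule simple_graph_detach[OF G dom(1) ns]) blast
      note fin' = simple_graphD(1)[OF G']
      have n: "?n = Suc (card V')" using V' fin' by simp
      have NV: "N = V'" using N(1,3) dom(2) n fin' by (intro card_subset_eq) auto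
      have "small_slack V' (degree V' E')"
        using small_slack_dominating_iff[OF fin' V'(2), of "degree V' E'" ?d] degree_less_card[OF G']
          d NV ss V'(1) dom(2) n by simp
      then have "buildable V' E'" using IH[OF G'] V' by auto
      then show ?thesis using buildable.dominating[of V' E' x] V' N(2) NV by simp
    next
      case inner
      then interpret no_extreme_vertex_step V E
        using G ss IH by unfold_locales
      show ?thesis by (rule buildable_without_extreme_vertices)
    qed
  qed
qed

theorem theorem3p2:
  fixes V :: "'a set" and E :: "'a set set"
  assumes "simple_graph V E"
  shows "weakly_threshold_graph V E \<longleftrightarrow> buildable V E"
  using assms small_slack_imp_buildable buildable_imp_small_slack
    weakly_threshold_sequence_iff_small_slack[OF simple_graphD(1,2)[OF assms]]
  unfolding weakly_threshold_graph_def by blast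

end
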